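(* Let $G$ be a finite group, let $P(g)=\frac{r(g)}{|G|}$ for $g\in G$, where $r(g)=|\{h\in G : h^2=g\}|$, let $P^{(n)}$ be the $n$-fold convolution of $P$, and let $U(g)=\frac{1}{|G|}$ be the uniform probability on $G$. Then for every integer $n\ge 1$, $$\|P^{(n)}-U\|=\frac{1}{|G|}\sqrt{\sum_{\chi\in R(G)} d_\chi^{\,2(-n+1)}},$$ where $R(G)$ is the set of all real-valued non-principal irreducible complex characters of $G$ and $d_\chi=\chi(1)$ is the degree of $\chi$.
   Context: The convolution of two functions $P,Q$ on $G$ is $(P*Q)(h)=\sum_{g\in G}P(g)Q(g^{-1}h)$, $h\in G$, and $P^{(n)}=P*\cdots*P$ ($n$ factors). The norm $\|\cdot\|$ is the one induced by the scalar product $(F_1,F_2)=\frac{1}{|G|}\sum_{g\in G}F_1(g)\overline{F_2(g)}$ on complex functions on $G$. A character is called real if all its values are real numbers. The principal character is the constant function $\mathbf{1}_G$. An empty sum is $0$. *)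

theory Defs
  imports "HOL-Algebra.Coset" "Jordan_Normal_Form.VS_Connect"
begin

section \<open>Functions on a finite group\<close>

definition num_square_roots :: "('a, 'b) monoid_scheme \<Rightarrow> 'a \<Rightarrow> nat" where
  "num_square_roots G g = card {h \<in> carrier G. h [^]\<^bsub>G\<^esub> (2::nat) = g}"

definition square_prob :: "('a, 'b) monoid_scheme \<Rightarrow> 'a \<Rightarrow> complex" where
  "square_prob G g = of_nat (num_square_roots G g) / of_nat (Coset.order G)"

definition uniform_prob :: "('a, 'b) monoid_scheme \<Rightarrow> 'a \<Rightarrow> complex" where
  "uniform_prob G g = 1 / of_nat (Coset.order G)"

definition convolution ::
  "('a, 'b) monoid_scheme \<Rightarrow> ('a \<Rightarrow> complex) \<Rightarrow> ('a \<Rightarrow> complex) \<Rightarrow> 'a \<Rightarrow> complex" where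
  "convolution G P Q h = (\<Sum>g\<in>carrier G. P g * Q (inv\<^bsub>G\<^esub> g \<otimes>\<^bsub>G\<^esub> h))"

text \<open>The convolution of \<open>n\<close> copies of \<open>P\<close>, for \<open>n \<ge> 1\<close>; the value at \<open>n = 0\<close> is not used.\<close>

definition conv_power ::
  "('a, 'b) monoid_scheme \<Rightarrow> ('a \<Rightarrow> complex) \<Rightarrow> nat \<Rightarrow> 'a \<Rightarrow> complex" where
  "conv_power G P n = (convolution G P ^^ (n - 1)) P"

definition group_inner ::
  "('a, 'b) monoid_scheme \<Rightarrow> ('a \<Rightarrow> complex) \<Rightarrow> ('a \<Rightarrow> complex) \<Rightarrow> complex" where
  "group_inner G F1 F2 = 1 / of_nat (Coset.order G) * (\<Sum>g\<in>carrier G. F1 g * cnj (F2 g))"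

text \<open>\<open>group_inner G F F\<close> is real and nonnegative; \<open>Re\<close> only changes its type.\<close>

definition group_norm :: "('a, 'b) monoid_scheme \<Rightarrow> ('a \<Rightarrow> complex) \<Rightarrow> real" where
  "group_norm G F = sqrt (Re (group_inner G F F))"


section \<open>Irreducible complex characters\<close>

text \<open>Matrix representations are homomorphisms into the group of units of the
  ring of complex \<open>n \<times> n\<close> matrices, that is, into \<open>GL n\<close>.\<close>

definition is_rep :: "('a, 'b) monoid_scheme \<Rightarrow> nat \<Rightarrow> ('a \<Rightarrow> complex mat) \<Rightarrow> bool" where
  "is_rep G n \<rho> \<longleftrightarrow> \<rho> \<in> hom G (units_of (ring_mat TYPE(complex) n ()))"

definition invariant_subspace ::
  "('a, 'b) monoid_scheme \<Rightarrow> nat \<Rightarrow> ('a \<Rightarrow> complex mat) \<Rightarrow> complex vec set \<Rightarrow> bool" where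
  "invariant_subspace G n \<rho> W \<longleftrightarrow>
     subspace class_ring W (module_vec TYPE(complex) n) \<and>
     (\<forall>g\<in>carrier G. \<forall>w\<in>W. \<rho> g *\<^sub>v w \<in> W)"

definition irreducible_rep :: "('a, 'b) monoid_scheme \<Rightarrow> nat \<Rightarrow> ('a \<Rightarrow> complex mat) \<Rightarrow> bool" where
  "irreducible_rep G n \<rho> \<longleftrightarrow> is_rep G n \<rho> \<and> n > 0 \<and>
     (\<forall>W. invariant_subspace G n \<rho> W \<longrightarrow> W = {0\<^sub>v n} \<or> W = carrier_vec n)"

definition mat_trace :: "complex mat \<Rightarrow> complex" where
  "mat_trace A = (\<Sum>i<dim_row A. A $$ (i, i))"

text \<open>Characters are restricted to the carrier (with value \<open>undefined\<close> outside it), so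
  that two characters are equal as HOL functions iff they agree on the group.\<close>

definition rep_character :: "('a, 'b) monoid_scheme \<Rightarrow> ('a \<Rightarrow> complex mat) \<Rightarrow> 'a \<Rightarrow> complex" where
  "rep_character G \<rho> = (\<lambda>g\<in>carrier G. mat_trace (\<rho> g))"

definition irreducible_characters :: "('a, 'b) monoid_scheme \<Rightarrow> ('a \<Rightarrow> complex) set" where
  "irreducible_characters G = {rep_character G \<rho> |n \<rho>. irreducible_rep G n \<rho>}"

definition principal_character :: "('a, 'b) monoid_scheme \<Rightarrow> 'a \<Rightarrow> complex" where
  "principal_character G = (\<lambda>g\<in>carrier G. 1)"

definition real_irreducible_characters :: "('a, 'b) monoid_scheme \<Rightarrow> ('a \<Rightarrow> complex) set" where
  "real_irreducible_characters G =
     {\<chi> \<in> irreducible_characters G. (\<forall>g\<in>carrier G. \<chi> g \<in> \<real>) \<and> \<chi> \<noteq> principal_character G}"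

text \<open>\<open>\<chi> \<one>\<close> is the trace of an identity matrix; \<open>Re\<close> only changes its type.\<close>

definition char_degree :: "('a, 'b) monoid_scheme \<Rightarrow> ('a \<Rightarrow> complex) \<Rightarrow> real" where
  "char_degree G \<chi> = Re (\<chi> \<one>\<^bsub>G\<^esub>)"

end

theory Submission
  imports Defs "Jordan_Normal_Form.Spectral_Radius"
begin

text \<open>
  The function \<open>r\<close> is a class function, and its coefficient at an irreducible character \<open>\<chi>\<close> is the
  Frobenius--Schur indicator \<open>\<nu>(\<chi>) = |G|\<^sup>-\<^sup>1 \<Sum>\<^sub>g \<chi>(g\<^sup>2)\<close>, which is \<open>\<plusminus>1\<close> if \<open>\<chi>\<close> is real and \<open>0\<close> otherwise. Since
  \<open>\<chi> * \<chi> = (|G| / d\<^sub>\<chi>) \<chi>\<close> and distinct irreducible characters convolve to \<open>0\<close>, the \<open>n\<close>-fold convolution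
  has the coefficients \<open>\<nu>(\<chi>)\<^sup>n / (|G| d\<^sub>\<chi>\<^sup>n\<^sup>-\<^sup>1)\<close>. Subtracting \<open>U\<close> removes the principal character, and the
  norm is read off by orthonormality.
\<close>

section \<open>Complex matrices\<close>

text \<open>The expansion of \<open>r\<close> rests on the irreducible characters spanning the class
  functions, and most of the work goes there. This is tested on one representation, the regular one,
  since there a function can be read off from the matrix by which it acts. Representations being
  matrix valued, a subspace is replaced by an injective matrix \<open>E\<close> having it as range;
  a subrepresentation is then a solution of \<open>\<rho> g * E = E * \<rho>' g\<close>, and
  embeddings compose by multiplication. The sums are indexed by characters, not representations. So
  orthogonality is stated for unequal characters, and that equal characters force equivalence is
  derived before the indicator of a real character is computed. Both
  \<open>\<chi> (inv g) = cnj (\<chi> g)\<close> and the indicator come from comparing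
  \<open>\<rho>\<close> with a dual: the adjoint one in the first case, the transposed one in the
  second. No sign depending on \<open>n\<close> survives because the squared norm contains the
  indicator only through an even power.\<close>

lemma subspace_vec_iff:
  "VectorSpace.subspace class_ring W (module_vec TYPE(complex) n) \<longleftrightarrow>
     W \<subseteq> carrier_vec n \<and> 0\<^sub>v n \<in> W \<and> (\<forall>v\<in>W. \<forall>w\<in>W. v + w \<in> W) \<and> (\<forall>c. \<forall>v\<in>W. c \<cdot>\<^sub>v v \<in> W)"
proof -
  interpret vec_space "TYPE(complex)" n .
  have "vectorspace class_ring (module_vec TYPE(complex) n)" "Module.module class_ring (module_vec TYPE(complex) n)"
    by (unfold_locales)
  then show ?thesis
    unfolding VectorSpace.subspace_def submodule_def by (auto simp: module_vec_simps)
qed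

lemma kernel_mat_subspace:
  assumes "A \<in> carrier_mat n m"
  shows "VectorSpace.subspace class_ring {v \<in> carrier_vec m. A *\<^sub>v v = 0\<^sub>v n} (module_vec TYPE(complex) m)"
  using assms unfolding subspace_vec_iff
  by (auto simp: mult_add_distrib_mat_vec[of _ n m] mult_mat_vec[of _ n m])

lemma range_mat_subspace:
  assumes A: "A \<in> carrier_mat n m"
  shows "VectorSpace.subspace class_ring ((*\<^sub>v) A ` carrier_vec m) (module_vec TYPE(complex) n)"
  unfolding subspace_vec_iff
proof (intro conjI allI ballI)
  show "0\<^sub>v n \<in> (*\<^sub>v) A ` carrier_vec m"
    using A by (intro image_eqI[of _ _ "0\<^sub>v m"]) auto
next
  fix v w assume "v \<in> (*\<^sub>v) A ` carrier_vec m" "w \<in> (*\<^sub>v) A ` carrier_vec m"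
  then obtain x y where "x \<in> carrier_vec m" "y \<in> carrier_vec m" "v = A *\<^sub>v x" "w = A *\<^sub>v y"
    by blast
  then show "v + w \<in> (*\<^sub>v) A ` carrier_vec m"
    using mult_add_distrib_mat_vec[OF A] by (intro image_eqI[of _ _ "x + y"]) auto
next
  fix c v assume "v \<in> (*\<^sub>v) A ` carrier_vec m"
  then obtain x where "x \<in> carrier_vec m" "v = A *\<^sub>v x"
    by blast
  then show "c \<cdot>\<^sub>v v \<in> (*\<^sub>v) A ` carrier_vec m"
    using mult_mat_vec[OF A] by (intro image_eqI[of _ _ "c \<cdot>\<^sub>v x"]) auto
qed (use A in auto)

text \<open>Linear independence of the columns, phrased as a trivial kernel. Such a matrix serves as
  a basis of its range.\<close>

definition inj_mat :: "complex mat \<Rightarrow> bool" where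
  "inj_mat A \<longleftrightarrow> (\<forall>v\<in>carrier_vec (dim_col A). A *\<^sub>v v = 0\<^sub>v (dim_row A) \<longrightarrow> v = 0\<^sub>v (dim_col A))"

lemma inj_matD:
  assumes "inj_mat A" "A \<in> carrier_mat n m" "v \<in> carrier_vec m" "A *\<^sub>v v = 0\<^sub>v n"
  shows "v = 0\<^sub>v m"
  using assms by (auto simp: inj_mat_def)

lemma inj_mat_cancel_vec:
  assumes A: "inj_mat A" "A \<in> carrier_mat n m" and v: "v \<in> carrier_vec m" "w \<in> carrier_vec m"
    and eq: "A *\<^sub>v v = A *\<^sub>v w"
  shows "v = w"
proof -
  have "A *\<^sub>v (v - w) = 0\<^sub>v n"
    using A(2) v eq by (simp add: mult_minus_distrib_mat_vec)
  then have "v - w = 0\<^sub>v m" using inj_matD[OF A] v by auto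
  then have "\<And>i. i < m \<Longrightarrow> (v - w) $ i = 0" by simp
  then show ?thesis using v by (intro eq_vecI) auto
qed

lemma inj_mat_cancel:
  assumes A: "inj_mat A" "A \<in> carrier_mat n m" and B: "B \<in> carrier_mat m k" "C \<in> carrier_mat m k"
    and eq: "A * B = A * C"
  shows "B = C"
proof (rule mat_col_eqI)
  fix j assume "j < dim_col C"
  then have j: "j < k" using B by auto
  have "A *\<^sub>v col B j = A *\<^sub>v col C j"
    using eq col_mult2[OF A(2) B(1) j] col_mult2[OF A(2) B(2) j] by simp
  then show "col B j = col C j"
    using inj_mat_cancel_vec[OF A] B j by auto
qed (use B in auto)

lemma mult_mat_unit_vec:
  fixes A :: "complex mat"
  assumes "A \<in> carrier_mat n m" "j < m"
  shows "A *\<^sub>v unit_vec m j = col A j"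
  using assms by (intro eq_vecI) auto

text \<open>Turns a statement about ranges into a matrix equation: the columns of \<open>X\<close>
  are preimages under \<open>E\<close>, chosen one column of \<open>A\<close> at a time.\<close>

lemma factor_through_range:
  fixes A E :: "complex mat"
  assumes E: "E \<in> carrier_mat n d" and A: "A \<in> carrier_mat n m"
    and cols: "\<And>j. j < m \<Longrightarrow> \<exists>v\<in>carrier_vec d. col A j = E *\<^sub>v v"
  obtains X where "X \<in> carrier_mat d m" "A = E * X"
proof -
  have "\<forall>j\<in>{..<m}. \<exists>v. v \<in> carrier_vec d \<and> col A j = E *\<^sub>v v" using cols by blast
  then obtain f where f: "\<And>j. j < m \<Longrightarrow> f j \<in> carrier_vec d \<and> col A j = E *\<^sub>v f j"
    by (metis lessThan_iff)
  define X where "X = mat d m (\<lambda>(i,j). f j $ i)"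
  have X: "X \<in> carrier_mat d m" by (simp add: X_def)
  have cX: "col X j = f j" if "j < m" for j
    using that f[OF that] by (intro eq_vecI) (auto simp: X_def)
  have "A = E * X"
    by (rule mat_col_eqI) (use A E X f cX in auto)
  with X show ?thesis by (rule that)
qed

lemma inj_square_mat_invertible:
  assumes A: "inj_mat A" "A \<in> carrier_mat n n"
  obtains B where "B \<in> carrier_mat n n" "A * B = 1\<^sub>m n" "B * A = 1\<^sub>m n"
proof -
  have "det A \<noteq> 0"
    using det_0_iff_vec_prod_zero[OF A(2)] inj_matD[OF A] by blast
  from det_non_zero_imp_unit[OF A(2) this, of "()"] show ?thesis
    using that by (auto simp: Units_def ring_mat_simps)
qed

lemma inj_square_mat_surj:
  assumes A: "inj_mat A" "A \<in> carrier_mat n n" and v: "v \<in> carrier_vec n"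
  obtains w where "w \<in> carrier_vec n" "A *\<^sub>v w = v"
proof -
  obtain B where B: "B \<in> carrier_mat n n" "A * B = 1\<^sub>m n"
    using inj_square_mat_invertible[OF A] by blast
  have "A *\<^sub>v (B *\<^sub>v v) = v"
    using A(2) B v by (metis assoc_mult_mat_vec one_mult_mat_vec)
  with B v show ?thesis by (intro that[of "B *\<^sub>v v"]) auto
qed

lemma inj_square_mat_range:
  assumes "inj_mat A" "A \<in> carrier_mat n n"
  shows "(*\<^sub>v) A ` carrier_vec n = carrier_vec n"
proof
  show "carrier_vec n \<subseteq> (*\<^sub>v) A ` carrier_vec n"
    using inj_square_mat_surj[OF assms] by (metis image_eqI subsetI)
qed (use assms in auto)

text \<open>If \<open>n < d\<close>, padding \<open>E\<close> with zero rows gives an injective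
  square matrix, which is therefore onto; but row \<open>n\<close>, the first padded one, is zero,
  so \<open>unit_vec d n\<close> is not reached.\<close>

lemma inj_mat_dim_le:
  assumes E: "inj_mat E" "E \<in> carrier_mat n d"
  shows "d \<le> n"
proof (rule ccontr)
  assume "\<not> d \<le> n"
  then have nd: "n < d" by simp
  define F where "F = mat d d (\<lambda>(i,j). if i < n then E $$ (i,j) else 0)"
  have F: "F \<in> carrier_mat d d" by (simp add: F_def)
  have FE: "(F *\<^sub>v v) $ i = (if i < n then (E *\<^sub>v v) $ i else 0)"
    if "i < d" "v \<in> carrier_vec d" for i v
    using that E(2) by (auto simp: F_def scalar_prod_def)
  have "inj_mat F"
    unfolding inj_mat_def
  proof (intro ballI impI)
    fix v assume v: "v \<in> carrier_vec (dim_col F)" and 0: "F *\<^sub>v v = 0\<^sub>v (dim_row F)"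
    then have vd: "v \<in> carrier_vec d" using F by simp
    have "(E *\<^sub>v v) $ i = 0" if "i < n" for i
      using FE[of i v] that nd vd 0 F by auto
    then have "E *\<^sub>v v = 0\<^sub>v n" using E(2) by (intro eq_vecI) auto
    then show "v = 0\<^sub>v (dim_col F)" using inj_matD[OF E] vd F by auto
  qed
  then obtain w where w: "w \<in> carrier_vec d" "F *\<^sub>v w = unit_vec d n"
    using inj_square_mat_surj[OF _ F, of "unit_vec d n"] by auto
  then have "(F *\<^sub>v w) $ n = 1" using nd by simp
  with FE[of n w] nd w show False by simp
qed

lemma zero_mat_range:
  assumes "\<And>v. v \<in> carrier_vec m \<Longrightarrow> A *\<^sub>v v = 0\<^sub>v n"
  shows "(*\<^sub>v) A ` carrier_vec m = {0\<^sub>v n :: complex vec}"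
proof -
  have "(*\<^sub>v) A ` carrier_vec m = (\<lambda>_. 0\<^sub>v n) ` (carrier_vec m :: complex vec set)"
    using assms by (intro image_cong) auto
  moreover have "(carrier_vec m :: complex vec set) \<noteq> {}" using zero_carrier_vec by blast
  ultimately show ?thesis by auto
qed

text \<open>Among the injective matrices whose range lies in \<open>W\<close>, one of maximal width
  is taken; widths are bounded by \<open>n\<close>. A vector of \<open>W\<close> outside its range
  could be appended as a further column.\<close>

lemma subspace_basis_mat:
  assumes W: "VectorSpace.subspace class_ring W (module_vec TYPE(complex) n)"
  obtains d E where "E \<in> carrier_mat n d" "inj_mat E" "W = (*\<^sub>v) E ` carrier_vec d"
proof -
  note W' = W[unfolded subspace_vec_iff]
  define P where "P d \<longleftrightarrow> (\<exists>E. E \<in> carrier_mat n d \<and> inj_mat E \<and> (\<forall>v\<in>carrier_vec d. E *\<^sub>v v \<in> W))" for d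
  \<comment> \<open>The matrix without columns starts the search. It is also the answer for the zero
    subspace, so later uses must exclude \<open>d = 0\<close> themselves.\<close>
  have "P 0"
  proof -
    have "E *\<^sub>v v = 0\<^sub>v n" if "E \<in> carrier_mat n 0" "v \<in> carrier_vec 0" for E and v :: "complex vec"
      using that by (intro eq_vecI) (auto simp: scalar_prod_def)
    then show ?thesis
      unfolding P_def using W' by (intro exI[of _ "0\<^sub>m n 0"]) (auto simp: inj_mat_def)
  qed
  moreover have "d \<le> n" if "P d" for d using that inj_mat_dim_le unfolding P_def by blast
  ultimately obtain d where d: "P d" and max: "\<And>e. P e \<Longrightarrow> e \<le> d"
    using GreatestI_nat[of P 0 n] Greatest_le_nat[of P _ n] by blast
  from d obtain E where E: "E \<in> carrier_mat n d" "inj_mat E" and EW: "\<And>v. v \<in> carrier_vec d \<Longrightarrow> E *\<^sub>v v \<in> W"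
    unfolding P_def by blast
  have "w \<in> (*\<^sub>v) E ` carrier_vec d" if w: "w \<in> W" for w
  proof (rule ccontr)
    assume nw: "w \<notin> (*\<^sub>v) E ` carrier_vec d"
    have wn: "w \<in> carrier_vec n" using w W' by auto
    define F where "F = mat n (Suc d) (\<lambda>(i,j). if j < d then E $$ (i,j) else w $ i)"
    have F: "F \<in> carrier_mat n (Suc d)" by (simp add: F_def)
    have Fv: "F *\<^sub>v v = E *\<^sub>v vec d (($) v) + (v $ d) \<cdot>\<^sub>v w" if "v \<in> carrier_vec (Suc d)" for v
      using that E wn
      by (intro eq_vecI) (auto simp: F_def scalar_prod_def mult.commute)
    have "inj_mat F"
      unfolding inj_mat_def
    proof (intro ballI impI)
      fix v assume "v \<in> carrier_vec (dim_col F)" and "F *\<^sub>v v = 0\<^sub>v (dim_row F)"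
      then have v: "v \<in> carrier_vec (Suc d)" and 0: "F *\<^sub>v v = 0\<^sub>v n" using F by auto
      let ?u = "vec d (($) v)"
      have sum: "E *\<^sub>v ?u + (v $ d) \<cdot>\<^sub>v w = 0\<^sub>v n" using Fv[OF v] 0 by simp
      have comp: "(E *\<^sub>v ?u) $ i + v $ d * w $ i = 0" if "i < n" for i
        using arg_cong[OF sum, of "\<lambda>x. x $ i"] that E wn by simp
      \<comment> \<open>A nonzero coefficient of the appended column could be divided out, placing
        \<open>w\<close> in the range of \<open>E\<close>.\<close>
      have vd: "v $ d = 0"
      proof (rule ccontr)
        assume nz: "v $ d \<noteq> 0"
        have "w = (- inverse (v $ d)) \<cdot>\<^sub>v (E *\<^sub>v ?u)"
        proof (rule eq_vecI)
          fix i assume "i < dim_vec ((- inverse (v $ d)) \<cdot>\<^sub>v (E *\<^sub>v ?u))"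
          then have i: "i < n" using E by simp
          have "(E *\<^sub>v ?u) $ i = - (v $ d * w $ i)" using comp[OF i] by (simp add: eq_neg_iff_add_eq_0)
          with nz i E show "w $ i = ((- inverse (v $ d)) \<cdot>\<^sub>v (E *\<^sub>v ?u)) $ i" by simp
        qed (use wn E in auto)
        also have "\<dots> = E *\<^sub>v ((- inverse (v $ d)) \<cdot>\<^sub>v ?u)" using E by (simp add: mult_mat_vec)
        finally show False using nw by auto
      qed
      have "E *\<^sub>v ?u = 0\<^sub>v n" using comp vd E by (intro eq_vecI) auto
      then have u0: "?u = 0\<^sub>v d" using inj_matD[OF E(2,1)] by auto
      have "v $ i = 0" if "i < Suc d" for i
        using arg_cong[OF u0, of "\<lambda>x. x $ i"] vd that by (cases "i = d") auto
      then show "v = 0\<^sub>v (dim_col F)" using v F by (intro eq_vecI) auto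
    qed
    moreover have "F *\<^sub>v v \<in> W" if "v \<in> carrier_vec (Suc d)" for v
      using Fv[OF that] EW[of "vec d (($) v)"] w W' by auto
    ultimately have "P (Suc d)" using F unfolding P_def by blast
    then show False using max by fastforce
  qed
  then have "W = (*\<^sub>v) E ` carrier_vec d" using EW by auto
  with E show ?thesis by (rule that)
qed

section \<open>Traces, adjoints, finite sums of matrices and matrix units\<close>

lemma index_mult_mat_sum:
  fixes A B :: "complex mat"
  assumes "A \<in> carrier_mat n m" "B \<in> carrier_mat m k" "i < n" "j < k"
  shows "(A * B) $$ (i,j) = (\<Sum>l<m. A $$ (i,l) * B $$ (l,j))"
  using assms by (simp add: scalar_prod_def lessThan_atLeast0)

lemma mat_trace_comm:
  assumes "A \<in> carrier_mat n m" "B \<in> carrier_mat m n"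
  shows "mat_trace (A * B) = mat_trace (B * A)"
proof -
  have "mat_trace (A * B) = (\<Sum>i<n. \<Sum>j<m. A $$ (i,j) * B $$ (j,i))"
    using assms by (auto simp: mat_trace_def scalar_prod_def lessThan_atLeast0 intro!: sum.cong)
  also have "\<dots> = (\<Sum>j<m. \<Sum>i<n. B $$ (j,i) * A $$ (i,j))"
    by (subst sum.swap) (simp add: mult.commute)
  also have "\<dots> = mat_trace (B * A)"
    using assms by (auto simp: mat_trace_def scalar_prod_def lessThan_atLeast0 intro!: sum.cong)
  finally show ?thesis .
qed

lemma mat_trace_one: "mat_trace (1\<^sub>m n) = of_nat n"
  by (simp add: mat_trace_def)

definition adjoint :: "complex mat \<Rightarrow> complex mat" where
  "adjoint A = mat (dim_col A) (dim_row A) (\<lambda>(i,j). cnj (A $$ (j,i)))"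

lemma adjoint_carrier [simp]: "A \<in> carrier_mat n m \<Longrightarrow> adjoint A \<in> carrier_mat m n"
  by (auto simp: adjoint_def)

lemma adjoint_index: "A \<in> carrier_mat n m \<Longrightarrow> i < m \<Longrightarrow> j < n \<Longrightarrow> adjoint A $$ (i,j) = cnj (A $$ (j,i))"
  by (auto simp: adjoint_def)

lemma adjoint_mult:
  assumes "A \<in> carrier_mat n m" "B \<in> carrier_mat m k"
  shows "adjoint (A * B) = adjoint B * adjoint A"
  using assms by (intro eq_matI) (auto simp: adjoint_def scalar_prod_def mult.commute intro!: sum.cong)

lemma adjoint_one [simp]: "adjoint (1\<^sub>m n) = 1\<^sub>m n"
  by (intro eq_matI) (auto simp: adjoint_def)

lemma adjoint_zero [simp]: "adjoint (0\<^sub>m n m) = 0\<^sub>m m n"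
  by (intro eq_matI) (auto simp: adjoint_def)

lemma adjoint_adjoint [simp]: "adjoint (adjoint A) = A"
  by (intro eq_matI) (auto simp: adjoint_def)

text \<open>For \<open>w = A *\<^sub>v v\<close>, the sum \<open>w \<bullet>c w\<close> regroups
  into the inner product of \<open>adjoint A *\<^sub>v w\<close> with \<open>v\<close>, hence
  vanishes. Thus the kernel of \<open>adjoint A\<close> meets the range of \<open>A\<close> only in
  zero.\<close>

lemma adjoint_ker:
  assumes A: "A \<in> carrier_mat n m" and v: "v \<in> carrier_vec m"
    and 0: "adjoint A *\<^sub>v (A *\<^sub>v v) = 0\<^sub>v m"
  shows "A *\<^sub>v v = 0\<^sub>v n"
proof -
  define w where "w = A *\<^sub>v v"
  have w: "w \<in> carrier_vec n" using A v by (simp add: w_def)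
  have wi: "w $ i = (\<Sum>j<m. A $$ (i,j) * v $ j)" if "i < n" for i
    using that A v by (auto simp: w_def scalar_prod_def lessThan_atLeast0 intro!: sum.cong)
  have 0: "(\<Sum>i<n. cnj (A $$ (i,j)) * w $ i) = 0" if "j < m" for j
    using arg_cong[OF 0, of "\<lambda>x. x $ j"] that A v w
    by (simp add: w_def[symmetric] scalar_prod_def lessThan_atLeast0 adjoint_def)
  have "w \<bullet>c w = (\<Sum>i<n. w $ i * cnj (w $ i))"
    using w by (auto simp: scalar_prod_def lessThan_atLeast0 intro!: sum.cong)
  also have "\<dots> = (\<Sum>i<n. \<Sum>j<m. cnj (v $ j) * (cnj (A $$ (i,j)) * w $ i))"
    by (intro sum.cong refl, subst (2) wi) (auto simp: sum_distrib_left mult_ac)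
  also have "\<dots> = (\<Sum>j<m. cnj (v $ j) * (\<Sum>i<n. cnj (A $$ (i,j)) * w $ i))"
    by (subst sum.swap) (simp add: sum_distrib_left)
  also have "\<dots> = 0" using 0 by simp
  finally show ?thesis using w by (simp add: w_def)
qed

text \<open>The dimensions are arguments because matrices of all sizes share one type, so the size
  of an empty sum has to be prescribed.\<close>

definition mat_sum :: "nat \<Rightarrow> nat \<Rightarrow> 'g set \<Rightarrow> ('g \<Rightarrow> complex mat) \<Rightarrow> complex mat" where
  "mat_sum n m S F = mat n m (\<lambda>(i,j). \<Sum>g\<in>S. F g $$ (i,j))"

lemma mat_sum_carrier [simp]: "mat_sum n m S F \<in> carrier_mat n m"
  by (simp add: mat_sum_def)

lemma mat_sum_index: "i < n \<Longrightarrow> j < m \<Longrightarrow> mat_sum n m S F $$ (i,j) = (\<Sum>g\<in>S. F g $$ (i,j))"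
  by (simp add: mat_sum_def)

lemma mult_mat_sum:
  assumes "A \<in> carrier_mat k n" "\<And>g. g \<in> S \<Longrightarrow> F g \<in> carrier_mat n m"
  shows "A * mat_sum n m S F = mat_sum k m S (\<lambda>g. A * F g)"
proof (rule eq_matI)
  fix i j assume "i < dim_row (mat_sum k m S (\<lambda>g. A * F g))" "j < dim_col (mat_sum k m S (\<lambda>g. A * F g))"
  then have ij: "i < k" "j < m" by (auto simp: mat_sum_def)
  have "(A * F g) $$ (i,j) = (\<Sum>l<n. A $$ (i,l) * F g $$ (l,j))" if "g \<in> S" for g
    using assms(1) assms(2)[OF that] ij by (auto simp: scalar_prod_def lessThan_atLeast0)
  then show "(A * mat_sum n m S F) $$ (i,j) = mat_sum k m S (\<lambda>g. A * F g) $$ (i,j)"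
    using assms(1) ij
    by (simp add: mat_sum_def scalar_prod_def lessThan_atLeast0 sum_distrib_left sum.swap[of _ S])
qed (use assms in \<open>auto simp: mat_sum_def\<close>)

lemma mat_sum_mult:
  assumes "A \<in> carrier_mat m k" "\<And>g. g \<in> S \<Longrightarrow> F g \<in> carrier_mat n m"
  shows "mat_sum n m S F * A = mat_sum n k S (\<lambda>g. F g * A)"
proof (rule eq_matI)
  fix i j assume "i < dim_row (mat_sum n k S (\<lambda>g. F g * A))" "j < dim_col (mat_sum n k S (\<lambda>g. F g * A))"
  then have ij: "i < n" "j < k" by (auto simp: mat_sum_def)
  have "(F g * A) $$ (i,j) = (\<Sum>l<m. F g $$ (i,l) * A $$ (l,j))" if "g \<in> S" for g
    using assms(1) assms(2)[OF that] ij by (auto simp: scalar_prod_def lessThan_atLeast0)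
  then show "(mat_sum n m S F * A) $$ (i,j) = mat_sum n k S (\<lambda>g. F g * A) $$ (i,j)"
    using assms(1) ij
    by (simp add: mat_sum_def scalar_prod_def lessThan_atLeast0 sum_distrib_right sum.swap[of _ S])
qed (use assms in \<open>auto simp: mat_sum_def\<close>)

lemma mat_sum_cong: "(\<And>g. g \<in> S \<Longrightarrow> F g = F' g) \<Longrightarrow> mat_sum n m S F = mat_sum n m S F'"
  by (auto simp: mat_sum_def intro!: eq_matI sum.cong)

lemma mat_sum_reindex:
  assumes "bij_betw p S S"
  shows "mat_sum n m S (\<lambda>g. F (p g)) = mat_sum n m S F"
  by (intro eq_matI) (auto simp: mat_sum_def sum.reindex_bij_betw[OF assms, of "\<lambda>g. F g $$ _"])

lemma mat_trace_mat_sum: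
  assumes "\<And>g. g \<in> S \<Longrightarrow> F g \<in> carrier_mat n n"
  shows "mat_trace (mat_sum n n S F) = (\<Sum>g\<in>S. mat_trace (F g))"
proof -
  have "mat_trace (F g) = (\<Sum>i<n. F g $$ (i,i))" if "g \<in> S" for g
    using assms[OF that] by (auto simp: mat_trace_def)
  then show ?thesis
    by (simp add: mat_trace_def mat_sum_def sum.swap[of _ S])
qed

lemma inj_mat_mult:
  assumes "A \<in> carrier_mat n m" "B \<in> carrier_mat m k" "inj_mat A" "inj_mat B"
  shows "inj_mat (A * B)"
  unfolding inj_mat_def
proof (intro ballI impI)
  fix v assume "v \<in> carrier_vec (dim_col (A * B))" and 0: "A * B *\<^sub>v v = 0\<^sub>v (dim_row (A * B))"
  then have v: "v \<in> carrier_vec k" using assms by simp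
  have "A *\<^sub>v (B *\<^sub>v v) = 0\<^sub>v n" using 0 assms v by simp
  then have "B *\<^sub>v v = 0\<^sub>v m" using inj_matD[OF assms(3,1)] assms(2) v by auto
  then show "v = 0\<^sub>v (dim_col (A * B))" using inj_matD[OF assms(4,2) v] assms by simp
qed

definition elem_mat :: "nat \<Rightarrow> nat \<Rightarrow> nat \<Rightarrow> nat \<Rightarrow> complex mat" where
  "elem_mat n m j k = mat n m (\<lambda>(a,b). if a = j \<and> b = k then 1 else 0)"

lemma elem_mat_carrier [simp]: "elem_mat n m j k \<in> carrier_mat n m"
  by (simp add: elem_mat_def)

text \<open>A matrix unit between two factors isolates a single product of entries. This is how
  Schur's lemma, a statement about matrices, yields orthogonality of matrix entries.\<close>

lemma mult_elem_mat_index: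
  assumes "A \<in> carrier_mat n n" "B \<in> carrier_mat m m" "i < n" "j < n" "k < m" "l < m"
  shows "(A * elem_mat n m j k * B) $$ (i,l) = A $$ (i,j) * B $$ (k,l)"
proof -
  have "(A * elem_mat n m j k) $$ (i,b) = (if b = k then A $$ (i,j) else 0)" if "b < m" for b
    using that assms by (auto simp: elem_mat_def scalar_prod_def if_distrib cong: if_cong)
  moreover have "A * elem_mat n m j k \<in> carrier_mat n m"
    using assms by (simp add: elem_mat_def)
  then have "(A * elem_mat n m j k * B) $$ (i,l) = (\<Sum>b<m. (A * elem_mat n m j k) $$ (i,b) * B $$ (b,l))"
    using assms by (intro index_mult_mat_sum)
  ultimately show ?thesis
    using assms by (simp add: if_distrib[of "\<lambda>x. x * _"] cong: if_cong)
qed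

lemma mat_trace_elem: "j < n \<Longrightarrow> k < n \<Longrightarrow> mat_trace (elem_mat n n j k) = (if j = k then 1 else 0)"
  by (auto simp: mat_trace_def elem_mat_def if_distrib cong: if_cong)


section \<open>Representations and Schur's lemma\<close>

locale fin_group = group G for G (structure) +
  assumes fin: "finite (carrier G)"
begin

text \<open>Forwards, \<open>\<rho> \<one>\<close> is idempotent and invertible, hence the identity.
  Backwards, \<open>\<rho> (inv g)\<close> is the inverse that makes \<open>\<rho> g\<close> a
  unit.\<close>

lemma is_rep_iff:
  "is_rep G n \<rho> \<longleftrightarrow> (\<forall>g\<in>carrier G. \<rho> g \<in> carrier_mat n n) \<and>
     (\<forall>g\<in>carrier G. \<forall>h\<in>carrier G. \<rho> (g \<otimes> h) = \<rho> g * \<rho> h) \<and> \<rho> \<one> = 1\<^sub>m n"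
proof
  assume "is_rep G n \<rho>"
  then have hom: "\<rho> \<in> hom G (units_of (ring_mat TYPE(complex) n ()))" by (simp add: is_rep_def)
  have U: "\<rho> g \<in> Units (ring_mat TYPE(complex) n ())" if "g \<in> carrier G" for g
    using hom_in_carrier[OF hom that] by (simp add: units_of_carrier)
  have m: "\<rho> (g \<otimes> h) = \<rho> g * \<rho> h" if "g \<in> carrier G" "h \<in> carrier G" for g h
    using hom_mult[OF hom that] by (simp add: units_of_mult ring_mat_simps)
  have c: "\<rho> g \<in> carrier_mat n n" if "g \<in> carrier G" for g
    using U[OF that] by (auto simp: Units_def ring_mat_simps)
  obtain B where B: "B \<in> carrier_mat n n" "B * \<rho> \<one> = 1\<^sub>m n"
    using U[of \<one>] by (auto simp: Units_def ring_mat_simps)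
  have "\<rho> \<one> = B * \<rho> \<one> * \<rho> \<one>" using B c[of \<one>] by simp
  also have "\<dots> = B * \<rho> \<one>"
    using B(1) c[of \<one>] m[of \<one> \<one>] by (simp add: assoc_mult_mat[of _ n n _ n _ n])
  finally show "(\<forall>g\<in>carrier G. \<rho> g \<in> carrier_mat n n) \<and>
     (\<forall>g\<in>carrier G. \<forall>h\<in>carrier G. \<rho> (g \<otimes> h) = \<rho> g * \<rho> h) \<and> \<rho> \<one> = 1\<^sub>m n"
    using c m B by simp
next
  assume r: "(\<forall>g\<in>carrier G. \<rho> g \<in> carrier_mat n n) \<and>
     (\<forall>g\<in>carrier G. \<forall>h\<in>carrier G. \<rho> (g \<otimes> h) = \<rho> g * \<rho> h) \<and> \<rho> \<one> = 1\<^sub>m n"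
  have "\<rho> g \<in> Units (ring_mat TYPE(complex) n ())" if "g \<in> carrier G" for g
  proof -
    have "\<rho> (inv g \<otimes> g) = \<rho> (inv g) * \<rho> g" "\<rho> (g \<otimes> inv g) = \<rho> g * \<rho> (inv g)"
      using r that inv_closed[OF that] by blast+
    then have "\<rho> (inv g) * \<rho> g = 1\<^sub>m n" "\<rho> g * \<rho> (inv g) = 1\<^sub>m n"
      unfolding l_inv[OF that] r_inv[OF that] using r by simp_all
    then show ?thesis using r that by (auto simp: Units_def ring_mat_simps intro!: bexI[of _ "\<rho> (inv g)"])
  qed
  then show "is_rep G n \<rho>"
    using r by (auto simp: is_rep_def hom_def units_of_carrier units_of_mult ring_mat_simps)
qed

lemma
  assumes "is_rep G n \<rho>"
  shows rep_carrier: "g \<in> carrier G \<Longrightarrow> \<rho> g \<in> carrier_mat n n"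
    and rep_mult: "g \<in> carrier G \<Longrightarrow> h \<in> carrier G \<Longrightarrow> \<rho> (g \<otimes> h) = \<rho> g * \<rho> h"
    and rep_one: "\<rho> \<one> = 1\<^sub>m n"
    and rep_inv: "g \<in> carrier G \<Longrightarrow> \<rho> (inv g) * \<rho> g = 1\<^sub>m n"
proof -
  note r = assms[unfolded is_rep_iff]
  show "g \<in> carrier G \<Longrightarrow> \<rho> g \<in> carrier_mat n n" and 1: "\<rho> \<one> = 1\<^sub>m n"
    and m: "g \<in> carrier G \<Longrightarrow> h \<in> carrier G \<Longrightarrow> \<rho> (g \<otimes> h) = \<rho> g * \<rho> h" for g h
    using r by blast+
  show "g \<in> carrier G \<Longrightarrow> \<rho> (inv g) * \<rho> g = 1\<^sub>m n" using m[of "inv g" g] 1 by simp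
qed

lemma irreducible_rep_is_rep: "irreducible_rep G n \<rho> \<Longrightarrow> is_rep G n \<rho>"
  and irreducible_rep_pos: "irreducible_rep G n \<rho> \<Longrightarrow> n > 0"
  by (auto simp: irreducible_rep_def)

lemma irreducible_repD:
  assumes "irreducible_rep G n \<rho>"
    and "VectorSpace.subspace class_ring W (module_vec TYPE(complex) n)"
    and "\<And>g v. g \<in> carrier G \<Longrightarrow> v \<in> W \<Longrightarrow> \<rho> g *\<^sub>v v \<in> W"
  shows "W = {0\<^sub>v n} \<or> W = carrier_vec n"
  using assms unfolding irreducible_rep_def invariant_subspace_def by simp

lemma rep_character_apply: "g \<in> carrier G \<Longrightarrow> rep_character G \<rho> g = mat_trace (\<rho> g)"
  by (simp add: rep_character_def)

text \<open>\<open>\<rho>' g\<close> is the action written in the coordinates given by the columns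
  of \<open>E\<close>. Cancelling the injective \<open>E\<close> on the left transfers
  multiplicativity and the value at \<open>\<one>\<close> from \<open>\<rho>\<close> to
  \<open>\<rho>'\<close>.\<close>

lemma rep_restrict_range:
  assumes r: "is_rep G n \<rho>" and E: "E \<in> carrier_mat n d" "inj_mat E"
    and inv: "\<And>g v. g \<in> carrier G \<Longrightarrow> v \<in> carrier_vec d \<Longrightarrow> \<exists>w\<in>carrier_vec d. \<rho> g *\<^sub>v (E *\<^sub>v v) = E *\<^sub>v w"
  shows "\<exists>\<rho>'. is_rep G d \<rho>' \<and> (\<forall>g\<in>carrier G. \<rho> g * E = E * \<rho>' g)"
proof -
  have "\<exists>X. X \<in> carrier_mat d d \<and> \<rho> g * E = E * X" if g: "g \<in> carrier G" for g
  proof -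
    have "\<exists>v\<in>carrier_vec d. col (\<rho> g * E) j = E *\<^sub>v v" if "j < d" for j
    proof -
      have "col (\<rho> g * E) j = \<rho> g *\<^sub>v (E *\<^sub>v unit_vec d j)"
        unfolding mult_mat_unit_vec[OF E(1) that] by (rule col_mult2[OF rep_carrier[OF r g] E(1) that])
      then show ?thesis using inv[OF g, of "unit_vec d j"] by auto
    qed
    from factor_through_range[OF E(1) mult_carrier_mat[OF rep_carrier[OF r g] E(1)] this]
    show ?thesis by blast
  qed
  then have "\<forall>g\<in>carrier G. \<exists>X. X \<in> carrier_mat d d \<and> \<rho> g * E = E * X" by blast
  from bchoice[OF this] obtain \<rho>' where "\<forall>g\<in>carrier G. \<rho>' g \<in> carrier_mat d d \<and> \<rho> g * E = E * \<rho>' g"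
    by blast
  then have X: "\<And>g. g \<in> carrier G \<Longrightarrow> \<rho>' g \<in> carrier_mat d d"
    and i: "\<And>g. g \<in> carrier G \<Longrightarrow> \<rho> g * E = E * \<rho>' g" by blast+
  have "\<rho>' (g \<otimes> h) = \<rho>' g * \<rho>' h" if gh: "g \<in> carrier G" "h \<in> carrier G" for g h
  proof (rule inj_mat_cancel[OF E(2,1)])
    note c = rep_carrier[OF r gh(1)] rep_carrier[OF r gh(2)] X[OF gh(1)] X[OF gh(2)] E(1)
    have "E * \<rho>' (g \<otimes> h) = \<rho> (g \<otimes> h) * E" using i gh by simp
    also have "\<dots> = \<rho> g * (\<rho> h * E)"
      unfolding rep_mult[OF r gh] by (rule assoc_mult_mat[OF c(1,2,5)])
    also have "\<dots> = \<rho> g * (E * \<rho>' h)" by (simp only: i gh)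
    also have "\<dots> = \<rho> g * E * \<rho>' h" by (rule assoc_mult_mat[OF c(1,5,4), symmetric])
    also have "\<dots> = E * \<rho>' g * \<rho>' h" by (simp only: i gh)
    also have "\<dots> = E * (\<rho>' g * \<rho>' h)" by (rule assoc_mult_mat[OF c(5,3,4)])
    finally show "E * \<rho>' (g \<otimes> h) = E * (\<rho>' g * \<rho>' h)" .
    show "\<rho>' (g \<otimes> h) \<in> carrier_mat d d" "\<rho>' g * \<rho>' h \<in> carrier_mat d d"
      using X gh mult_carrier_mat[OF c(3,4)] by auto
  qed
  moreover have "\<rho>' \<one> = 1\<^sub>m d"
  proof (rule inj_mat_cancel[OF E(2,1)])
    show "E * \<rho>' \<one> = E * 1\<^sub>m d" using i[of \<one>] E rep_one[OF r] by simp
  qed (use X in auto)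
  ultimately have "is_rep G d \<rho>'" using X unfolding is_rep_iff by blast
  then show ?thesis using i by (intro exI[of _ \<rho>'] conjI ballI)
qed

lemma invariant_subspace_rep:
  assumes r: "is_rep G n \<rho>" and W: "invariant_subspace G n \<rho> W"
  shows "\<exists>d E \<rho>'. E \<in> carrier_mat n d \<and> inj_mat E \<and> W = (*\<^sub>v) E ` carrier_vec d \<and>
    is_rep G d \<rho>' \<and> (\<forall>g\<in>carrier G. \<rho> g * E = E * \<rho>' g)"
proof -
  obtain d E where E: "E \<in> carrier_mat n d" "inj_mat E" "W = (*\<^sub>v) E ` carrier_vec d"
    using W unfolding invariant_subspace_def by (elim conjE subspace_basis_mat)
  have "\<exists>w\<in>carrier_vec d. \<rho> g *\<^sub>v (E *\<^sub>v v) = E *\<^sub>v w" if "g \<in> carrier G" "v \<in> carrier_vec d" for g v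
  proof -
    have "E *\<^sub>v v \<in> W" using that(2) unfolding E(3) by (rule imageI)
    then have "\<rho> g *\<^sub>v (E *\<^sub>v v) \<in> W" using W that(1) unfolding invariant_subspace_def by blast
    then show ?thesis unfolding E(3) by blast
  qed
  from rep_restrict_range[OF r E(1,2) this] E show ?thesis
    by (intro exI[of _ d] exI[of _ E]) simp
qed

text \<open>Descent on the dimension: a reducible representation has an invariant subspace of
  dimension strictly between 0 and \<open>n\<close>, and the embedding \<open>F\<close> found inside
  it composes with \<open>E\<close> to \<open>E * F\<close>.\<close>

lemma irreducible_subrep:
  assumes "is_rep G n \<rho>" "n > 0"
  shows "\<exists>d E \<rho>'. irreducible_rep G d \<rho>' \<and> E \<in> carrier_mat n d \<and> inj_mat E \<and>
           (\<forall>g\<in>carrier G. \<rho> g * E = E * \<rho>' g)"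
  using assms
proof (induction n arbitrary: \<rho> rule: less_induct)
  case (less n)
  note r = less.prems(1)
  show ?case
  proof (cases "irreducible_rep G n \<rho>")
    case True
    have "inj_mat (1\<^sub>m n)" by (auto simp: inj_mat_def)
    moreover have "\<rho> g * 1\<^sub>m n = 1\<^sub>m n * \<rho> g" if "g \<in> carrier G" for g using rep_carrier[OF r that] by simp
    ultimately show ?thesis using True by (intro exI[of _ n] exI[of _ "1\<^sub>m n"] exI[of _ \<rho>]) simp
  next
    case False
    then obtain W where W: "invariant_subspace G n \<rho> W" "W \<noteq> {0\<^sub>v n}" "W \<noteq> carrier_vec n"
      using less.prems by (auto simp: irreducible_rep_def)
    obtain d E \<rho>' where E: "E \<in> carrier_mat n d" "inj_mat E" "W = (*\<^sub>v) E ` carrier_vec d"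
      and r': "is_rep G d \<rho>'" and i: "\<And>g. g \<in> carrier G \<Longrightarrow> \<rho> g * E = E * \<rho>' g"
      using invariant_subspace_rep[OF r W(1)] by metis
    have "d \<noteq> 0"
    proof
      assume "d = 0"
      then have "E *\<^sub>v v = 0\<^sub>v n" if "v \<in> carrier_vec d" for v
        using that E(1) by (intro eq_vecI) (auto simp: scalar_prod_def)
      then have "W = {0\<^sub>v n}" unfolding E(3) by (rule zero_mat_range)
      then show False using W by simp
    qed
    moreover have "d \<noteq> n"
    proof
      assume "d = n"
      then have "W = carrier_vec n"
        using E inj_square_mat_range[of E n] by simp
      then show False using W by simp
    qed
    ultimately have "d > 0" "d < n" using inj_mat_dim_le[OF E(2,1)] by auto
    then obtain e F \<rho>'' where F: "irreducible_rep G e \<rho>''" "F \<in> carrier_mat d e" "inj_mat F"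
      and i': "\<forall>g\<in>carrier G. \<rho>' g * F = F * \<rho>'' g"
      using less.IH[OF _ r'] by metis
    have "\<rho> g * (E * F) = E * F * \<rho>'' g" if g: "g \<in> carrier G" for g
    proof -
      note c = rep_carrier[OF r g] rep_carrier[OF r' g] rep_carrier[OF irreducible_rep_is_rep[OF F(1)] g] E(1) F(2)
      have "\<rho> g * (E * F) = \<rho> g * E * F" by (rule assoc_mult_mat[OF c(1,4,5), symmetric])
      also have "\<dots> = E * \<rho>' g * F" by (simp only: i g)
      also have "\<dots> = E * (\<rho>' g * F)" by (rule assoc_mult_mat[OF c(4,2,5)])
      also have "\<dots> = E * (F * \<rho>'' g)" using i' g by simp
      also have "\<dots> = E * F * \<rho>'' g" by (rule assoc_mult_mat[OF c(4,5,3), symmetric])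
      finally show ?thesis .
    qed
    then show ?thesis
      using F(1) inj_mat_mult[OF E(1) F(2) E(2) F(3)] mult_carrier_mat[OF E(1) F(2)]
      by (intro exI[of _ e] exI[of _ "E * F"] exI[of _ \<rho>'']) simp
  qed
qed

text \<open>Kernel and range of an intertwiner are invariant, hence trivial or everything; since
  \<open>T\<close> is nonzero the kernel is zero and the range is full. Factoring the identity
  through the range gives a right inverse, and injectivity makes it two-sided.\<close>

lemma schur_invertible:
  assumes r: "irreducible_rep G n \<rho>" and r': "irreducible_rep G m \<rho>'"
    and T: "T \<in> carrier_mat n m" "T \<noteq> 0\<^sub>m n m"
    and i: "\<And>g. g \<in> carrier G \<Longrightarrow> \<rho> g * T = T * \<rho>' g"
  obtains S where "S \<in> carrier_mat m n" "T * S = 1\<^sub>m n" "S * T = 1\<^sub>m m" "n = m"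
proof -
  note rr = irreducible_rep_is_rep[OF r] and rr' = irreducible_rep_is_rep[OF r']
  have iv: "\<rho> g *\<^sub>v (T *\<^sub>v v) = T *\<^sub>v (\<rho>' g *\<^sub>v v)" if "g \<in> carrier G" "v \<in> carrier_vec m" for g v
    using assoc_mult_mat_vec[OF rep_carrier[OF rr that(1)] T(1) that(2)]
      assoc_mult_mat_vec[OF T(1) rep_carrier[OF rr' that(1)] that(2)] i[OF that(1)] by simp
  have cv: "\<rho>' g *\<^sub>v v \<in> carrier_vec m" if "g \<in> carrier G" "v \<in> carrier_vec m" for g v
    using rep_carrier[OF rr' that(1)] that by simp
  let ?K = "{v \<in> carrier_vec m. T *\<^sub>v v = 0\<^sub>v n}"
  have "?K = {0\<^sub>v m} \<or> ?K = carrier_vec m"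
  proof (rule irreducible_repD[OF r' kernel_mat_subspace[OF T(1)]])
    fix g v assume g: "g \<in> carrier G" and v: "v \<in> ?K"
    have "\<rho> g *\<^sub>v 0\<^sub>v n = 0\<^sub>v n" using rep_carrier[OF rr g] by auto
    then show "\<rho>' g *\<^sub>v v \<in> ?K" using iv[OF g, of v] cv[OF g, of v] v by simp
  qed
  moreover have "?K \<noteq> carrier_vec m"
  proof
    assume K: "?K = carrier_vec m"
    have "T = 0\<^sub>m n m"
    proof (rule mat_col_eqI)
      fix j assume "j < dim_col (0\<^sub>m n m :: complex mat)"
      then have j: "j < m" by simp
      have "unit_vec m j \<in> ?K" unfolding K by simp
      then have "T *\<^sub>v unit_vec m j = 0\<^sub>v n" by simp
      then show "col T j = col (0\<^sub>m n m) j" using mult_mat_unit_vec[OF T(1) j] j by simp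
    qed (use T in auto)
    then show False using T by simp
  qed
  ultimately have K: "?K = {0\<^sub>v m}" by simp
  have inj: "inj_mat T" unfolding inj_mat_def
  proof (intro ballI impI)
    fix v assume "v \<in> carrier_vec (dim_col T)" "T *\<^sub>v v = 0\<^sub>v (dim_row T)"
    then have "v \<in> ?K" using T by auto
    then show "v = 0\<^sub>v (dim_col T)" using K T by auto
  qed
  let ?R = "(*\<^sub>v) T ` carrier_vec m"
  have "?R = {0\<^sub>v n} \<or> ?R = carrier_vec n"
  proof (rule irreducible_repD[OF r range_mat_subspace[OF T(1)]])
    show "\<rho> g *\<^sub>v v \<in> ?R" if g: "g \<in> carrier G" and v: "v \<in> ?R" for g v
    proof -
      obtain x where x: "x \<in> carrier_vec m" "v = T *\<^sub>v x" using v unfolding image_iff by blast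
      then show ?thesis using iv[OF g x(1)] cv[OF g x(1)] by simp
    qed
  qed
  moreover have "?R \<noteq> {0\<^sub>v n}"
  proof
    assume R: "?R = {0\<^sub>v n}"
    have "T *\<^sub>v unit_vec m 0 \<in> ?R" by simp
    then have "unit_vec m 0 \<in> ?K" unfolding R by simp
    then have "unit_vec m 0 = (0\<^sub>v m :: complex vec)" unfolding K by simp
    then have "unit_vec m 0 $ 0 = (0\<^sub>v m :: complex vec) $ 0" by simp
    then show False using irreducible_rep_pos[OF r'] by simp
  qed
  ultimately have R: "?R = carrier_vec n" by simp
  have "\<exists>v\<in>carrier_vec m. col (1\<^sub>m n) j = T *\<^sub>v v" if "j < n" for j
  proof -
    have "unit_vec n j \<in> ?R" unfolding R by simp
    then show ?thesis using that by auto
  qed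
  from factor_through_range[OF T(1) one_carrier_mat this]
  obtain S where S: "S \<in> carrier_mat m n" "1\<^sub>m n = T * S" by metis
  have "S * T = 1\<^sub>m m"
  proof (rule inj_mat_cancel[OF inj T(1)])
    show "T * (S * T) = T * 1\<^sub>m m"
      using assoc_mult_mat[OF T(1) S(1) T(1)] S(2)[symmetric] T by simp
  qed (use S T in auto)
  \<comment> \<open>The sizes agree because they are the traces of \<open>T * S\<close> and
    \<open>S * T\<close>.\<close>
  moreover have "(of_nat n :: complex) = of_nat m"
    using mat_trace_comm[OF T(1) S(1)] S(2) \<open>S * T = 1\<^sub>m m\<close> mat_trace_one by metis
  ultimately show ?thesis using that S by (simp only: of_nat_eq_iff)
qed

lemma intertwiner_character_eq:
  assumes r: "is_rep G n \<rho>" and r': "is_rep G m \<rho>'"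
    and T: "T \<in> carrier_mat n m" and S: "S \<in> carrier_mat m n" "T * S = 1\<^sub>m n"
    and i: "\<And>g. g \<in> carrier G \<Longrightarrow> \<rho> g * T = T * \<rho>' g" and ST: "S * T = 1\<^sub>m m"
  shows "rep_character G \<rho> = rep_character G \<rho>'"
proof -
  have "mat_trace (\<rho> g) = mat_trace (\<rho>' g)" if g: "g \<in> carrier G" for g
  proof -
    note c = rep_carrier[OF r g] rep_carrier[OF r' g]
    have "\<rho> g = \<rho> g * (T * S)" using c S by simp
    also have "\<dots> = T * \<rho>' g * S"
      unfolding i[OF g, symmetric] by (rule assoc_mult_mat[OF c(1) T S(1), symmetric])
    also have "\<dots> = T * (\<rho>' g * S)" by (rule assoc_mult_mat[OF T c(2) S(1)])
    finally have "mat_trace (\<rho> g) = mat_trace (T * (\<rho>' g * S))" by simp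
    also have "\<dots> = mat_trace (\<rho>' g * S * T)" using c T S by (intro mat_trace_comm[of _ n m]) auto
    also have "\<dots> = mat_trace (\<rho>' g)"
      using assoc_mult_mat[OF c(2) S(1) T] c ST by simp
    finally show ?thesis .
  qed
  then show ?thesis unfolding rep_character_def by (auto simp: restrict_def)
qed

text \<open>Over the complex numbers \<open>T\<close> has an eigenvalue \<open>c\<close>. The
  intertwiner \<open>D = T - c\<close> kills an eigenvector, so it is not invertible and must
  vanish.\<close>

lemma schur_scalar:
  assumes r: "irreducible_rep G n \<rho>" and T: "T \<in> carrier_mat n n"
    and i: "\<And>g. g \<in> carrier G \<Longrightarrow> \<rho> g * T = T * \<rho> g"
  obtains c where "T = c \<cdot>\<^sub>m 1\<^sub>m n"
proof -
  note rr = irreducible_rep_is_rep[OF r]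
  obtain c where "c \<in> spectrum T" using spectrum_non_empty[OF T irreducible_rep_pos[OF r]] by auto
  then obtain v where v: "v \<in> carrier_vec n" "v \<noteq> 0\<^sub>v n" "T *\<^sub>v v = c \<cdot>\<^sub>v v"
    using T by (auto simp: spectrum_def eigenvalue_def eigenvector_def)
  define D where "D = T - c \<cdot>\<^sub>m 1\<^sub>m n"
  have D: "D \<in> carrier_mat n n" using T by (auto simp: D_def minus_carrier_mat)
  have Dv: "D *\<^sub>v v = 0\<^sub>v n"
  proof -
    have "D *\<^sub>v v = T *\<^sub>v v - (c \<cdot>\<^sub>m 1\<^sub>m n) *\<^sub>v v" unfolding D_def
      using T v by (intro minus_mult_distrib_mat_vec) auto
    also have "(c \<cdot>\<^sub>m 1\<^sub>m n) *\<^sub>v v = c \<cdot>\<^sub>v v" using v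
      by (intro eq_vecI) auto
    finally show ?thesis using v by simp
  qed
  have "\<rho> g * D = D * \<rho> g" if g: "g \<in> carrier G" for g
    using i[OF g] rep_carrier[OF rr g] T
    by (simp add: D_def mult_minus_distrib_mat[of _ n n] minus_mult_distrib_mat[of _ n n]
        mult_smult_distrib[of "\<rho> g" n n "1\<^sub>m n" n] mult_smult_assoc_mat[of "1\<^sub>m n" n n "\<rho> g" n])
  then have "D = 0\<^sub>m n n"
  proof (rule_tac ccontr)
    assume "D \<noteq> 0\<^sub>m n n" and "\<And>g. g \<in> carrier G \<Longrightarrow> \<rho> g * D = D * \<rho> g"
    from schur_invertible[OF r r D this] obtain S where S: "S \<in> carrier_mat n n" "S * D = 1\<^sub>m n" by metis
    have "v = S * D *\<^sub>v v" using S v by simp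
    also have "\<dots> = S *\<^sub>v (D *\<^sub>v v)" using S(1) D v(1) by (rule assoc_mult_mat_vec)
    also have "\<dots> = 0\<^sub>v n" using Dv S by auto
    finally show False using v by simp
  qed
  have "T = c \<cdot>\<^sub>m 1\<^sub>m n"
  proof (rule eq_matI)
    fix a b assume "a < dim_row (c \<cdot>\<^sub>m 1\<^sub>m n)" "b < dim_col (c \<cdot>\<^sub>m 1\<^sub>m n)"
    then have ab: "a < n" "b < n" by auto
    have "D $$ (a,b) = 0" using \<open>D = 0\<^sub>m n n\<close> ab by simp
    then show "T $$ (a,b) = (c \<cdot>\<^sub>m 1\<^sub>m n) $$ (a,b)" using ab T by (simp add: D_def)
  qed (use T in auto)
  then show ?thesis by (rule that)
qed

text \<open>\<open>\<sigma>\<close> abstracts transpose and adjoint: an involution reversing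
  products, which \<open>inv g\<close> reverses back. If \<open>E\<close> is a basis of an invariant
  subspace \<open>W\<close> of the dual, the kernel of \<open>\<sigma> E\<close> is its annihilator
  and is invariant under \<open>\<rho>\<close>. A zero annihilator forces \<open>d = n\<close>, so
  \<open>W\<close> is everything; a full one forces \<open>E\<close> and hence \<open>W\<close> to
  be zero.\<close>

lemma dual_irreducible:
  assumes r: "irreducible_rep G n \<rho>"
    and \<sigma>: "\<And>A a b. A \<in> carrier_mat a b \<Longrightarrow> \<sigma> A \<in> carrier_mat b a"
      "\<And>A B a b c. A \<in> carrier_mat a b \<Longrightarrow> B \<in> carrier_mat b c \<Longrightarrow> \<sigma> (A * B) = \<sigma> B * \<sigma> A"
      "\<And>k. \<sigma> (1\<^sub>m k) = 1\<^sub>m k" "\<And>A. \<sigma> (\<sigma> A) = A" "\<And>a b. \<sigma> (0\<^sub>m a b) = 0\<^sub>m b a"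
  shows "irreducible_rep G n (\<lambda>g. \<sigma> (\<rho> (inv g)))"
proof -
  note rr = irreducible_rep_is_rep[OF r]
  have d: "is_rep G n (\<lambda>g. \<sigma> (\<rho> (inv g)))"
    unfolding is_rep_iff
    using rep_carrier[OF rr] rep_mult[OF rr] rep_one[OF rr]
    by (auto simp: \<sigma> inv_mult_group \<sigma>(2)[of _ n n _ n])
  have "W = {0\<^sub>v n} \<or> W = carrier_vec n" if W: "invariant_subspace G n (\<lambda>g. \<sigma> (\<rho> (inv g))) W" for W
  proof -
    obtain d E \<rho>' where E: "E \<in> carrier_mat n d" "inj_mat E" "W = (*\<^sub>v) E ` carrier_vec d"
      and r': "is_rep G d \<rho>'" and i: "\<And>g. g \<in> carrier G \<Longrightarrow> \<sigma> (\<rho> (inv g)) * E = E * \<rho>' g"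
      using invariant_subspace_rep[OF d W] by metis
    note sE = \<sigma>(1)[OF E(1)]
    have j: "\<sigma> E * \<rho> g = \<sigma> (\<rho>' (inv g)) * \<sigma> E" if g: "g \<in> carrier G" for g
    proof -
      have c: "\<rho> g \<in> carrier_mat n n" "\<rho>' (inv g) \<in> carrier_mat d d"
        using g rep_carrier[OF rr] rep_carrier[OF r'] by auto
      have "\<sigma> (\<sigma> (\<rho> g) * E) = \<sigma> (E * \<rho>' (inv g))" using i[of "inv g"] g by simp
      then show ?thesis using \<sigma>(2)[OF \<sigma>(1)[OF c(1)] E(1)] \<sigma>(2)[OF E(1) c(2)] \<sigma>(4) by simp
    qed
    let ?K = "{v \<in> carrier_vec n. \<sigma> E *\<^sub>v v = 0\<^sub>v d}"
    have "?K = {0\<^sub>v n} \<or> ?K = carrier_vec n"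
    proof (rule irreducible_repD[OF r kernel_mat_subspace[OF sE]])
      fix g v assume g: "g \<in> carrier G" and v: "v \<in> ?K"
      have c: "\<rho> g \<in> carrier_mat n n" "\<sigma> (\<rho>' (inv g)) \<in> carrier_mat d d"
        using g rep_carrier[OF rr] rep_carrier[OF r'] \<sigma>(1) by auto
      have vn: "v \<in> carrier_vec n" using v by simp
      have "\<sigma> E *\<^sub>v (\<rho> g *\<^sub>v v) = \<sigma> E * \<rho> g *\<^sub>v v" by (rule assoc_mult_mat_vec[OF sE c(1) vn, symmetric])
      also have "\<dots> = \<sigma> (\<rho>' (inv g)) *\<^sub>v (\<sigma> E *\<^sub>v v)"
        unfolding j[OF g] by (rule assoc_mult_mat_vec[OF c(2) sE vn])
      also have "\<dots> = 0\<^sub>v d" using v c by auto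
      finally show "\<rho> g *\<^sub>v v \<in> ?K" using c v by auto
    qed
    then show ?thesis
    proof
      assume K: "?K = {0\<^sub>v n}"
      have "inj_mat (\<sigma> E)" unfolding inj_mat_def using K sE by auto
      then have "n \<le> d" using inj_mat_dim_le sE by blast
      then have "n = d" using inj_mat_dim_le[OF E(2,1)] by simp
      then have "W = carrier_vec n"
        using E inj_square_mat_range[of E n] by simp
      then show ?thesis ..
    next
      assume K: "?K = carrier_vec n"
      have "\<sigma> E = 0\<^sub>m d n"
      proof (rule mat_col_eqI)
        fix j assume "j < dim_col (0\<^sub>m d n :: complex mat)"
        then have j: "j < n" by simp
        have "unit_vec n j \<in> ?K" unfolding K by simp
        then have "\<sigma> E *\<^sub>v unit_vec n j = 0\<^sub>v d" by simp
        then show "col (\<sigma> E) j = col (0\<^sub>m d n) j" using mult_mat_unit_vec[OF sE j] j by simp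
      qed (use sE in auto)
      then have "E = 0\<^sub>m n d" using \<sigma>(4,5) by metis
      then have E0: "E *\<^sub>v v = 0\<^sub>v n" if "v \<in> carrier_vec d" for v
        using that by (intro eq_vecI) auto
      then have "W = {0\<^sub>v n}" unfolding E(3) by (rule zero_mat_range)
      then show ?thesis ..
    qed
  qed
  then show ?thesis using d irreducible_rep_pos[OF r] unfolding irreducible_rep_def by blast
qed

lemma transpose_dual_irreducible:
  assumes "irreducible_rep G n \<rho>"
  shows "irreducible_rep G n (\<lambda>g. transpose_mat (\<rho> (inv g)))"
  by (rule dual_irreducible[OF assms]) (auto simp: transpose_mult)

lemma adjoint_dual_irreducible:
  assumes "irreducible_rep G n \<rho>"
  shows "irreducible_rep G n (\<lambda>g. adjoint (\<rho> (inv g)))"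
  by (rule dual_irreducible[OF assms]) (auto simp: adjoint_mult)


section \<open>Schur orthogonality\<close>

lemma bij_mult_left: "h \<in> carrier G \<Longrightarrow> bij_betw ((\<otimes>) h) (carrier G) (carrier G)"
  by (intro bij_betwI[of _ _ _ "(\<otimes>) (inv h)"]) (auto simp flip: m_assoc)

lemma bij_inv: "bij_betw (\<lambda>g. inv g) (carrier G) (carrier G)"
  by (intro bij_betwI[of _ _ _ "\<lambda>g. inv g"]) auto

lemma order_pos: "0 < Coset.order G"
  using order_gt_0_iff_finite fin by blast

text \<open>Unnormalised: divided by the group order, this is the projection onto the matrices
  intertwining \<open>\<rho>\<close> and \<open>\<rho>'\<close>.\<close>

definition avg :: "nat \<Rightarrow> ('a \<Rightarrow> complex mat) \<Rightarrow> nat \<Rightarrow> ('a \<Rightarrow> complex mat) \<Rightarrow> complex mat \<Rightarrow> complex mat" where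
  "avg n \<rho> m \<rho>' A = mat_sum n m (carrier G) (\<lambda>g. \<rho> g * A * \<rho>' (inv g))"

lemma avg_carrier [simp]: "avg n \<rho> m \<rho>' A \<in> carrier_mat n m"
  by (simp add: avg_def)

text \<open>The factor \<open>\<rho> h\<close> on the left is absorbed by replacing \<open>g\<close>
  with \<open>h \<otimes> g\<close>, which releases \<open>\<rho>' h\<close> on the right.\<close>

lemma avg_intertwines:
  assumes r: "is_rep G n \<rho>" and r': "is_rep G m \<rho>'" and A: "A \<in> carrier_mat n m" and h: "h \<in> carrier G"
  shows "\<rho> h * avg n \<rho> m \<rho>' A = avg n \<rho> m \<rho>' A * \<rho>' h"
proof -
  note c = rep_carrier[OF r] rep_carrier[OF r']
  have t: "\<rho> g * A * \<rho>' (inv g) \<in> carrier_mat n m" if "g \<in> carrier G" for g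
    using c(1)[OF that] c(2)[of "inv g"] that A by simp
  have "\<rho> h * avg n \<rho> m \<rho>' A = mat_sum n m (carrier G) (\<lambda>g. \<rho> h * (\<rho> g * A * \<rho>' (inv g)))"
    unfolding avg_def using c(1)[OF h] t by (rule mult_mat_sum)
  also have "\<dots> = mat_sum n m (carrier G) (\<lambda>g. \<rho> (h \<otimes> g) * A * \<rho>' (inv (h \<otimes> g)) * \<rho>' h)"
  proof (rule mat_sum_cong)
    fix g assume g: "g \<in> carrier G"
    have "inv g = inv (h \<otimes> g) \<otimes> h" using g h by (simp add: inv_mult_group m_assoc)
    then have "\<rho>' (inv g) = \<rho>' (inv (h \<otimes> g)) * \<rho>' h"
      using rep_mult[OF r', of "inv (h \<otimes> g)" h] g h by simp
    moreover have "\<rho> (h \<otimes> g) = \<rho> h * \<rho> g" using rep_mult[OF r h g] .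
    moreover have "\<rho> h \<in> carrier_mat n n" "\<rho> g \<in> carrier_mat n n" "\<rho>' h \<in> carrier_mat m m"
      "\<rho>' (inv (h \<otimes> g)) \<in> carrier_mat m m" using c g h by auto
    ultimately show "\<rho> h * (\<rho> g * A * \<rho>' (inv g)) = \<rho> (h \<otimes> g) * A * \<rho>' (inv (h \<otimes> g)) * \<rho>' h"
      using A by (simp add: assoc_mult_mat[of _ n n _ n _ m] assoc_mult_mat[of _ n n _ m _ m]
          assoc_mult_mat[of _ n m _ m _ m])
  qed
  also have "\<dots> = mat_sum n m (carrier G) (\<lambda>g. \<rho> g * A * \<rho>' (inv g) * \<rho>' h)"
    by (rule mat_sum_reindex[OF bij_mult_left[OF h], of n m "\<lambda>g. \<rho> g * A * \<rho>' (inv g) * \<rho>' h"])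
  also have "\<dots> = avg n \<rho> m \<rho>' A * \<rho>' h"
    unfolding avg_def using c(2)[OF h] t by (rule mat_sum_mult[symmetric])
  finally show ?thesis .
qed

lemma avg_elem_index:
  assumes r: "is_rep G n \<rho>" and r': "is_rep G m \<rho>'" and "i < n" "j < n" "k < m" "l < m"
  shows "avg n \<rho> m \<rho>' (elem_mat n m j k) $$ (i,l) = (\<Sum>g\<in>carrier G. \<rho> g $$ (i,j) * \<rho>' (inv g) $$ (k,l))"
  using assms rep_carrier[OF r] rep_carrier[OF r']
  by (simp add: avg_def mat_sum_index mult_elem_mat_index)

text \<open>The sum is an entry of the average of a matrix unit. By Schur's lemma a nonzero average
  would be invertible, and conjugation by it would make the characters equal.\<close>

lemma schur_orthogonality_distinct:
  assumes r: "irreducible_rep G n \<rho>" and r': "irreducible_rep G m \<rho>'"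
    and ne: "rep_character G \<rho> \<noteq> rep_character G \<rho>'"
    and ix: "i < n" "j < n" "k < m" "l < m"
  shows "(\<Sum>g\<in>carrier G. \<rho> g $$ (i,j) * \<rho>' (inv g) $$ (k,l)) = 0"
proof -
  note rr = irreducible_rep_is_rep[OF r] and rr' = irreducible_rep_is_rep[OF r']
  let ?T = "avg n \<rho> m \<rho>' (elem_mat n m j k)"
  have i: "\<rho> g * ?T = ?T * \<rho>' g" if "g \<in> carrier G" for g
    by (rule avg_intertwines[OF rr rr' _ that]) simp
  have "?T = 0\<^sub>m n m"
  proof (rule ccontr)
    assume "?T \<noteq> 0\<^sub>m n m"
    then obtain S where "S \<in> carrier_mat m n" "?T * S = 1\<^sub>m n" "S * ?T = 1\<^sub>m m"
      using schur_invertible[OF r r' avg_carrier _ i] by metis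
    then have "rep_character G \<rho> = rep_character G \<rho>'"
      using intertwiner_character_eq[OF rr rr' avg_carrier _ _ i] by blast
    with ne show False by simp
  qed
  then show ?thesis using avg_elem_index[OF rr rr' ix] ix by simp
qed

text \<open>The average of a matrix unit is a scalar matrix \<open>c\<close>. Each of its summands
  has the trace of the matrix unit, so \<open>c * n\<close> is the group order if
  \<open>j = k\<close> and 0 otherwise.\<close>

lemma schur_orthogonality_same:
  assumes r: "irreducible_rep G n \<rho>"
    and ix: "i < n" "j < n" "k < n" "l < n"
  shows "(\<Sum>g\<in>carrier G. \<rho> g $$ (i,j) * \<rho> (inv g) $$ (k,l)) =
    (if i = l \<and> j = k then of_nat (Coset.order G) / of_nat n else 0)"
proof -
  note rr = irreducible_rep_is_rep[OF r]
  let ?E = "elem_mat n n j k"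
  let ?T = "avg n \<rho> n \<rho> ?E"
  obtain c where c: "?T = c \<cdot>\<^sub>m 1\<^sub>m n"
    using schur_scalar[OF r avg_carrier] avg_intertwines[OF rr rr elem_mat_carrier] by metis
  have "mat_trace ?T = c * of_nat n"
    unfolding c by (simp add: mat_trace_def)
  moreover have "mat_trace ?T = (\<Sum>g\<in>carrier G. mat_trace (\<rho> g * ?E * \<rho> (inv g)))"
    unfolding avg_def by (rule mat_trace_mat_sum) (use rep_carrier[OF rr] in \<open>auto intro!: mult_carrier_mat[of _ n n]\<close>)
  moreover have "mat_trace (\<rho> g * ?E * \<rho> (inv g)) = (if j = k then 1 else 0)" if g: "g \<in> carrier G" for g
  proof -
    have cg: "\<rho> g \<in> carrier_mat n n" "\<rho> (inv g) \<in> carrier_mat n n" using rep_carrier[OF rr] g by auto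
    have "mat_trace (\<rho> g * ?E * \<rho> (inv g)) = mat_trace (\<rho> (inv g) * (\<rho> g * ?E))"
      using cg by (intro mat_trace_comm[of _ n n]) auto
    also have "\<rho> (inv g) * (\<rho> g * ?E) = \<rho> (inv g) * \<rho> g * ?E"
      by (rule assoc_mult_mat[OF cg(2,1) elem_mat_carrier, symmetric])
    also have "\<dots> = ?E" unfolding rep_inv[OF rr g] by (simp add: left_mult_one_mat[OF elem_mat_carrier])
    finally show ?thesis using mat_trace_elem ix by simp
  qed
  ultimately have "c * of_nat n = (if j = k then of_nat (Coset.order G) else 0)"
    by (cases "j = k") (simp_all add: Coset.order_def)
  then have "c = (if j = k then of_nat (Coset.order G) / of_nat n else 0)"
    using irreducible_rep_pos[OF r] by (auto simp: field_simps)
  then show ?thesis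
    using avg_elem_index[OF rr rr ix] c ix by (cases "i = l"; cases "j = k") simp_all
qed

section \<open>Convolution of irreducible characters, and equivalence from equality of
  characters\<close>

lemma rep_character_sum:
  assumes "is_rep G n \<rho>" "g \<in> carrier G"
  shows "rep_character G \<rho> g = (\<Sum>i<n. \<rho> g $$ (i,i))"
  using assms rep_carrier[OF assms] by (auto simp: rep_character_apply mat_trace_def)

lemma rep_character_one:
  assumes "is_rep G n \<rho>"
  shows "rep_character G \<rho> \<one> = of_nat n"
  using rep_one[OF assms] by (simp add: rep_character_apply mat_trace_one)

lemma rep_character_outside: "g \<notin> carrier G \<Longrightarrow> rep_character G \<rho> g = undefined"
  by (simp add: rep_character_def)

text \<open>Writing the second character at \<open>inv g \<otimes> h\<close> as the trace of
  \<open>\<rho>' (inv g) * \<rho>' h\<close> takes \<open>h\<close> out of the sum over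
  \<open>g\<close>; the inner sums are those of the orthogonality relations.\<close>

lemma convolution_character_expand:
  assumes r: "is_rep G n \<rho>" and r': "is_rep G m \<rho>'" and h: "h \<in> carrier G"
  shows "convolution G (rep_character G \<rho>) (rep_character G \<rho>') h =
    (\<Sum>i<n. \<Sum>k<m. \<Sum>l<m. \<rho>' h $$ (l,k) * (\<Sum>g\<in>carrier G. \<rho> g $$ (i,i) * \<rho>' (inv g) $$ (k,l)))"
proof -
  have "rep_character G \<rho>' (inv g \<otimes> h) = (\<Sum>k<m. \<Sum>l<m. \<rho>' (inv g) $$ (k,l) * \<rho>' h $$ (l,k))"
    if g: "g \<in> carrier G" for g
  proof -
    have "\<rho>' (inv g) \<in> carrier_mat m m" "\<rho>' h \<in> carrier_mat m m" using g h rep_carrier[OF r'] by auto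
    then show ?thesis
      using rep_character_sum[OF r', of "inv g \<otimes> h"] rep_mult[OF r', of "inv g" h] g h
      by (simp add: scalar_prod_def lessThan_atLeast0)
  qed
  then have "convolution G (rep_character G \<rho>) (rep_character G \<rho>') h =
    (\<Sum>g\<in>carrier G. (\<Sum>i<n. \<rho> g $$ (i,i)) * (\<Sum>k<m. \<Sum>l<m. \<rho>' (inv g) $$ (k,l) * \<rho>' h $$ (l,k)))"
    using rep_character_sum[OF r] by (simp add: convolution_def)
  also have "\<dots> = (\<Sum>g\<in>carrier G. \<Sum>i<n. \<Sum>k<m. \<Sum>l<m. \<rho>' h $$ (l,k) * (\<rho> g $$ (i,i) * \<rho>' (inv g) $$ (k,l)))"
    by (simp add: sum_distrib_left sum_distrib_right mult_ac sum.swap[of _ "{..<n}"])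
  also have "\<dots> = (\<Sum>i<n. \<Sum>k<m. \<Sum>l<m. \<Sum>g\<in>carrier G. \<rho>' h $$ (l,k) * (\<rho> g $$ (i,i) * \<rho>' (inv g) $$ (k,l)))"
    by (simp only: sum.swap[of _ "carrier G"])
  finally show ?thesis by (simp add: sum_distrib_left)
qed

lemma convolution_character_distinct:
  assumes r: "irreducible_rep G n \<rho>" and r': "irreducible_rep G m \<rho>'" and h: "h \<in> carrier G"
    and ne: "rep_character G \<rho> \<noteq> rep_character G \<rho>'"
  shows "convolution G (rep_character G \<rho>) (rep_character G \<rho>') h = 0"
  using convolution_character_expand[OF irreducible_rep_is_rep[OF r] irreducible_rep_is_rep[OF r'] h]
    schur_orthogonality_distinct[OF r r' ne] by simp

lemma convolution_character_same:
  assumes r: "irreducible_rep G n \<rho>" and h: "h \<in> carrier G"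
  shows "convolution G (rep_character G \<rho>) (rep_character G \<rho>) h =
    of_nat (Coset.order G) / of_nat n * rep_character G \<rho> h"
proof -
  note rr = irreducible_rep_is_rep[OF r]
  let ?c = "of_nat (Coset.order G) / of_nat n :: complex"
  have "convolution G (rep_character G \<rho>) (rep_character G \<rho>) h =
    (\<Sum>i<n. \<Sum>k<n. \<Sum>l<n. if l = i then if k = i then \<rho> h $$ (l,k) * ?c else 0 else 0)"
    unfolding convolution_character_expand[OF rr rr h]
    by (intro sum.cong refl) (auto simp: schur_orthogonality_same[OF r])
  also have "\<dots> = (\<Sum>i<n. \<rho> h $$ (i,i) * ?c)"
    by (intro sum.cong refl) (simp add: sum.delta)
  also have "\<dots> = ?c * rep_character G \<rho> h"
    unfolding rep_character_sum[OF rr h] by (simp add: sum_distrib_left mult.commute)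
  finally show ?thesis .
qed

text \<open>If the averages of all matrix units vanished, so would the convolution of the two
  characters at \<open>\<one>\<close>. For equal characters that value is the group order, so some
  average is a nonzero intertwiner and Schur's lemma inverts it.\<close>

lemma equal_characters_intertwiner:
  assumes r: "irreducible_rep G n \<rho>" and r': "irreducible_rep G m \<rho>'"
    and eq: "rep_character G \<rho> = rep_character G \<rho>'"
  shows "\<exists>T S. T \<in> carrier_mat n n \<and> S \<in> carrier_mat n n \<and> T * S = 1\<^sub>m n \<and> S * T = 1\<^sub>m n \<and>
    n = m \<and> (\<forall>g\<in>carrier G. \<rho> g * T = T * \<rho>' g)"
proof -
  note rr = irreducible_rep_is_rep[OF r] and rr' = irreducible_rep_is_rep[OF r']
  have i: "\<rho> g * avg n \<rho> m \<rho>' (elem_mat n m j k) = avg n \<rho> m \<rho>' (elem_mat n m j k) * \<rho>' g"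
    if "g \<in> carrier G" for g j k
    by (rule avg_intertwines[OF rr rr' _ that]) simp
  have "\<exists>j<n. \<exists>k<m. avg n \<rho> m \<rho>' (elem_mat n m j k) \<noteq> 0\<^sub>m n m"
  proof (rule ccontr)
    assume "\<not> ?thesis"
    then have "(\<Sum>g\<in>carrier G. \<rho> g $$ (i,i) * \<rho>' (inv g) $$ (k,l)) = 0"
      if "i < n" "k < m" "l < m" for i k l
      using avg_elem_index[OF rr rr', of i i k l] that by auto
    then have "convolution G (rep_character G \<rho>) (rep_character G \<rho>') \<one> = 0"
      using convolution_character_expand[OF rr rr' one_closed] by simp
    moreover have "convolution G (rep_character G \<rho>) (rep_character G \<rho>) \<one> = of_nat (Coset.order G)"
      using convolution_character_same[OF r one_closed] rep_character_one[OF rr] irreducible_rep_pos[OF r]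
      by simp
    ultimately show False using eq order_pos by simp
  qed
  then obtain j k where "avg n \<rho> m \<rho>' (elem_mat n m j k) \<noteq> 0\<^sub>m n m" by blast
  from schur_invertible[OF r r' avg_carrier this i] i show ?thesis
    by (metis avg_carrier)
qed


section \<open>The Frobenius--Schur indicator\<close>

lemma transpose_dual_character:
  assumes "is_rep G n \<rho>" "g \<in> carrier G"
  shows "rep_character G (\<lambda>g. transpose_mat (\<rho> (inv g))) g = rep_character G \<rho> (inv g)"
  using assms rep_carrier[OF assms(1), of "inv g"] by (auto simp: rep_character_apply mat_trace_def)

text \<open>The claim says that \<open>\<rho>\<close> and its adjoint dual have the same character.
  Otherwise orthogonality of their (0,0) entries would make a sum of squared moduli vanish, although
  its term at \<open>\<one>\<close> is 1.\<close>

lemma rep_character_inv: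
  assumes r: "irreducible_rep G n \<rho>" and g: "g \<in> carrier G"
  shows "rep_character G \<rho> (inv g) = cnj (rep_character G \<rho> g)"
proof -
  note rr = irreducible_rep_is_rep[OF r] and pos = irreducible_rep_pos[OF r]
  let ?\<rho> = "\<lambda>g. adjoint (\<rho> (inv g))"
  have "rep_character G ?\<rho> = rep_character G \<rho>"
  proof (rule ccontr)
    assume ne: "rep_character G ?\<rho> \<noteq> rep_character G \<rho>"
    have "0 = (\<Sum>g\<in>carrier G. ?\<rho> g $$ (0,0) * \<rho> (inv g) $$ (0,0))"
      using schur_orthogonality_distinct[OF adjoint_dual_irreducible[OF r] r ne, of 0 0 0 0] pos by simp
    also have "\<dots> = (\<Sum>g\<in>carrier G. of_real ((cmod (\<rho> (inv g) $$ (0,0)))\<^sup>2))"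
      using pos rep_carrier[OF rr]
      by (intro sum.cong refl) (simp add: adjoint_index[of _ n n] complex_norm_square mult.commute del: of_real_power)
    finally have "complex_of_real (\<Sum>g\<in>carrier G. (cmod (\<rho> (inv g) $$ (0,0)))\<^sup>2) = 0"
      by (simp only: of_real_sum)
    then have "(\<Sum>g\<in>carrier G. (cmod (\<rho> (inv g) $$ (0,0)))\<^sup>2) = 0"
      by (simp only: of_real_eq_0_iff)
    then have "\<forall>g\<in>carrier G. \<rho> (inv g) $$ (0,0) = 0"
      using fin by (subst (asm) sum_nonneg_eq_0_iff) auto
    then have "\<rho> (inv \<one>) $$ (0,0) = 0" by blast
    then show False using rep_one[OF rr] pos by simp
  qed
  then have "rep_character G \<rho> (inv g) = rep_character G ?\<rho> (inv g)" by simp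
  also have "\<dots> = cnj (rep_character G \<rho> g)"
    using g rep_carrier[OF rr g] by (auto simp: rep_character_apply mat_trace_def adjoint_def intro!: sum.cong)
  finally show ?thesis .
qed

lemma rep_character_conj_class:
  assumes r: "is_rep G n \<rho>" and g: "g \<in> carrier G" and h: "h \<in> carrier G"
  shows "rep_character G \<rho> (h \<otimes> g \<otimes> inv h) = rep_character G \<rho> g"
proof -
  have c: "\<rho> g \<in> carrier_mat n n" "\<rho> h \<in> carrier_mat n n" "\<rho> (inv h) \<in> carrier_mat n n"
    using rep_carrier[OF r] g h by auto
  have "mat_trace (\<rho> (h \<otimes> g \<otimes> inv h)) = mat_trace (\<rho> h * \<rho> g * \<rho> (inv h))"
    using rep_mult[OF r, of "h \<otimes> g" "inv h"] rep_mult[OF r h g] g h by simp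
  also have "\<dots> = mat_trace (\<rho> (inv h) * (\<rho> h * \<rho> g))"
    using c by (intro mat_trace_comm[of _ n n]) auto
  also have "\<rho> (inv h) * (\<rho> h * \<rho> g) = \<rho> (inv h) * \<rho> h * \<rho> g"
    by (rule assoc_mult_mat[OF c(3,2,1), symmetric])
  also have "\<dots> = \<rho> g" unfolding rep_inv[OF r h] using c by simp
  finally show ?thesis using g h by (simp add: rep_character_apply)
qed

definition frobenius_schur :: "('a \<Rightarrow> complex) \<Rightarrow> complex" where
  "frobenius_schur \<chi> = (\<Sum>g\<in>carrier G. \<chi> (g \<otimes> g)) / of_nat (Coset.order G)"

text \<open>The trace of \<open>\<rho> g * \<rho> g\<close> pairs the entries \<open>(i,j)\<close>
  and \<open>(j,i)\<close>. The second is an entry of the transposed dual at \<open>inv g\<close>;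
  the doubled inverse brings the sum into the shape of the orthogonality relations between
  \<open>\<rho>\<close> and this dual.\<close>

lemma sum_square_character:
  assumes r: "is_rep G n \<rho>"
  shows "(\<Sum>g\<in>carrier G. rep_character G \<rho> (g \<otimes> g)) =
    (\<Sum>i<n. \<Sum>j<n. \<Sum>g\<in>carrier G. \<rho> g $$ (i,j) * transpose_mat (\<rho> (inv (inv g))) $$ (i,j))"
proof -
  have "(\<Sum>g\<in>carrier G. rep_character G \<rho> (g \<otimes> g)) =
    (\<Sum>g\<in>carrier G. \<Sum>i<n. \<Sum>j<n. \<rho> g $$ (i,j) * transpose_mat (\<rho> (inv (inv g))) $$ (i,j))"
  proof (intro sum.cong refl)
    fix g assume g: "g \<in> carrier G"
    show "rep_character G \<rho> (g \<otimes> g) =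
      (\<Sum>i<n. \<Sum>j<n. \<rho> g $$ (i,j) * transpose_mat (\<rho> (inv (inv g))) $$ (i,j))"
      using rep_carrier[OF r g] rep_character_sum[OF r, of "g \<otimes> g"] rep_mult[OF r g g] g
      by (simp add: scalar_prod_def lessThan_atLeast0)
  qed
  then show ?thesis by (simp only: sum.swap[of _ "carrier G"])
qed

text \<open>The transposed dual has the conjugate character, so one nonreal value separates it from
  \<open>\<rho>\<close> and orthogonality kills every term of the indicator.\<close>

lemma frobenius_schur_nonreal:
  assumes r: "irreducible_rep G n \<rho>" and nr: "g \<in> carrier G" "rep_character G \<rho> g \<notin> \<real>"
  shows "frobenius_schur (rep_character G \<rho>) = 0"
proof -
  note rr = irreducible_rep_is_rep[OF r]
  have "rep_character G \<rho> \<noteq> rep_character G (\<lambda>g. transpose_mat (\<rho> (inv g)))"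
    using transpose_dual_character[OF rr nr(1)] rep_character_inv[OF r nr(1)] nr(2)
    by (metis Reals_cnj_iff)
  from schur_orthogonality_distinct[OF r transpose_dual_irreducible[OF r] this]
  show ?thesis by (simp add: frobenius_schur_def sum_square_character[OF rr])
qed

text \<open>For a real character, \<open>\<rho>\<close> is equivalent to its dual by some matrix \<open>T\<close>; the transpose of
  \<open>T\<close> is again such an equivalence, so it is \<open>c T\<close> with \<open>c\<^sup>2 = 1\<close>, and \<open>c\<close> is the indicator.\<close>

lemma frobenius_schur_real:
  assumes r: "irreducible_rep G n \<rho>" and real: "\<And>g. g \<in> carrier G \<Longrightarrow> rep_character G \<rho> g \<in> \<real>"
  shows "(frobenius_schur (rep_character G \<rho>))\<^sup>2 = 1"
proof -
  note rr = irreducible_rep_is_rep[OF r] and pos = irreducible_rep_pos[OF r]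
  let ?d = "\<lambda>g. transpose_mat (\<rho> (inv g))"
  have d: "irreducible_rep G n ?d" by (rule transpose_dual_irreducible[OF r])
  note cd = rep_carrier[OF irreducible_rep_is_rep[OF d]] and cr = rep_carrier[OF rr]
  have "rep_character G \<rho> = rep_character G ?d"
  proof
    fix g show "rep_character G \<rho> g = rep_character G ?d g"
    proof (cases "g \<in> carrier G")
      case True
      then show ?thesis
        using transpose_dual_character[OF rr True] rep_character_inv[OF r True] real[OF True]
        by (metis Reals_cnj_iff)
    qed (simp add: rep_character_outside)
  qed
  then obtain T S where T: "T \<in> carrier_mat n n" and S: "S \<in> carrier_mat n n"
    and TS: "T * S = 1\<^sub>m n" and ST: "S * T = 1\<^sub>m n"
    and i: "\<And>g. g \<in> carrier G \<Longrightarrow> \<rho> g * T = T * ?d g"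
    using equal_characters_intertwiner[OF r d] by metis
  let ?U = "transpose_mat T"
  have U: "?U \<in> carrier_mat n n" using T by simp
  \<comment> \<open>Transposing the relation for \<open>inv g\<close> exchanges the roles of
    \<open>\<rho>\<close> and its dual, so the transpose intertwines in the same direction as
    \<open>T\<close>.\<close>
  have iU: "\<rho> g * ?U = ?U * ?d g" if g: "g \<in> carrier G" for g
  proof -
    have g': "inv g \<in> carrier G" using g by simp
    have "transpose_mat (\<rho> (inv g) * T) = transpose_mat (T * ?d (inv g))" using i[OF g'] by simp
    then show ?thesis
      using transpose_mult[OF cr[OF g'] T] transpose_mult[OF T cd[OF g']] g by simp
  qed
  have iS: "?d g * S = S * \<rho> g" if g: "g \<in> carrier G" for g
  proof -
    have "?d g = S * (T * ?d g)"
      using assoc_mult_mat[OF S T cd[OF g]] ST cd[OF g] by simp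
    also have "\<dots> = S * \<rho> g * T"
      unfolding i[OF g, symmetric] by (rule assoc_mult_mat[OF S cr[OF g] T, symmetric])
    finally have "?d g * S = S * \<rho> g * T * S" by simp
    also have "\<dots> = S * \<rho> g * (T * S)" by (rule assoc_mult_mat[OF mult_carrier_mat[OF S cr[OF g]] T S])
    finally show ?thesis using TS S cr[OF g] by (simp add: right_mult_one_mat[of _ n n])
  qed
  have "\<rho> g * (?U * S) = ?U * S * \<rho> g" if g: "g \<in> carrier G" for g
  proof -
    have "\<rho> g * (?U * S) = \<rho> g * ?U * S" by (rule assoc_mult_mat[OF cr[OF g] U S, symmetric])
    also have "\<dots> = ?U * (?d g * S)" unfolding iU[OF g] by (rule assoc_mult_mat[OF U cd[OF g] S])
    also have "\<dots> = ?U * S * \<rho> g" unfolding iS[OF g] by (rule assoc_mult_mat[OF U S cr[OF g], symmetric])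
    finally show ?thesis .
  qed
  then obtain c where c: "?U * S = c \<cdot>\<^sub>m 1\<^sub>m n"
    using schur_scalar[OF r mult_carrier_mat[OF U S]] by metis
  have UcT: "?U = c \<cdot>\<^sub>m T"
  proof -
    have "?U = ?U * S * T" using assoc_mult_mat[OF U S T] ST U by simp
    also have "\<dots> = c \<cdot>\<^sub>m T" unfolding c using T by (simp add: mult_smult_assoc_mat[of _ n n])
    finally show ?thesis .
  qed
  then have UT: "T $$ (b,a) = c * T $$ (a,b)" if "a < n" "b < n" for a b
  proof -
    have "T $$ (b,a) = ?U $$ (a,b)" using that T by simp
    also have "\<dots> = c * T $$ (a,b)" unfolding UcT using that T by simp
    finally show ?thesis .
  qed
  \<comment> \<open>Transposing twice multiplies an entry by \<open>c\<^sup>2\<close>; the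
    invertible \<open>T\<close> has a nonzero entry to compare.\<close>
  have cc: "c\<^sup>2 = 1"
  proof -
    have "\<exists>a<n. \<exists>b<n. T $$ (a,b) \<noteq> 0"
    proof (rule ccontr)
      assume "\<not> (\<exists>a<n. \<exists>b<n. T $$ (a,b) \<noteq> 0)"
      then have z: "T $$ (a,b) = 0" if "a < n" "b < n" for a b using that by blast
      have "(T * S) $$ (0,0) = 0" using T S pos z by (simp add: scalar_prod_def)
      then show False using TS pos by simp
    qed
    then obtain a b where ab: "a < n" "b < n" "T $$ (a,b) \<noteq> 0" by blast
    have "T $$ (a,b) = c * (c * T $$ (a,b))" using UT[OF ab(2,1)] UT[OF ab(1,2)] by simp
    then show ?thesis using ab by (simp add: power2_eq_square)
  qed
  \<comment> \<open>The dual is \<open>S * \<rho> * T\<close>. Expressing its entries through those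
    of \<open>\<rho>\<close> makes the orthogonality of \<open>\<rho>\<close> with itself
    applicable.\<close>
  have dinv: "?d (inv g) $$ (i,j) = (\<Sum>k<n. \<Sum>l<n. S $$ (i,k) * T $$ (l,j) * \<rho> (inv g) $$ (k,l))"
    if g: "g \<in> carrier G" and ij: "i < n" "j < n" for g i j
  proof -
    have g': "inv g \<in> carrier G" using g by simp
    have "?d (inv g) = S * (T * ?d (inv g))"
      using assoc_mult_mat[OF S T cd[OF g']] ST cd[OF g'] by simp
    then have "?d (inv g) = S * (\<rho> (inv g) * T)" using i[OF g'] by simp
    moreover have "(S * (\<rho> (inv g) * T)) $$ (i,j) = (\<Sum>k<n. S $$ (i,k) * (\<Sum>l<n. \<rho> (inv g) $$ (k,l) * T $$ (l,j)))"
      using S T cr[OF g'] ij by (simp add: scalar_prod_def lessThan_atLeast0)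
    ultimately show ?thesis by (simp add: sum_distrib_left mult_ac)
  qed
  let ?N = "of_nat (Coset.order G) / of_nat n :: complex"
  have inner: "(\<Sum>g\<in>carrier G. \<rho> g $$ (i,j) * ?d (inv g) $$ (i,j)) = ?N * (S $$ (i,j) * T $$ (i,j))"
    if ij: "i < n" "j < n" for i j
  proof -
    have "(\<Sum>g\<in>carrier G. \<rho> g $$ (i,j) * ?d (inv g) $$ (i,j)) =
      (\<Sum>g\<in>carrier G. \<Sum>k<n. \<Sum>l<n. S $$ (i,k) * T $$ (l,j) * (\<rho> g $$ (i,j) * \<rho> (inv g) $$ (k,l)))"
      using dinv[OF _ ij] by (intro sum.cong refl) (simp add: sum_distrib_left mult_ac)
    also have "\<dots> = (\<Sum>k<n. \<Sum>l<n. S $$ (i,k) * T $$ (l,j) * (\<Sum>g\<in>carrier G. \<rho> g $$ (i,j) * \<rho> (inv g) $$ (k,l)))"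
      by (simp only: sum.swap[of _ "carrier G"] sum_distrib_left)
    also have "\<dots> = (\<Sum>k<n. \<Sum>l<n. if l = i then if k = j then ?N * (S $$ (i,j) * T $$ (i,j)) else 0 else 0)"
      by (intro sum.cong refl) (auto simp: schur_orthogonality_same[OF r ij])
    also have "\<dots> = ?N * (S $$ (i,j) * T $$ (i,j))" using ij by simp
    finally show ?thesis .
  qed
  have "(\<Sum>g\<in>carrier G. rep_character G \<rho> (g \<otimes> g)) = (\<Sum>i<n. \<Sum>j<n. ?N * (S $$ (i,j) * T $$ (i,j)))"
    unfolding sum_square_character[OF rr] using inner by (intro sum.cong refl) auto
  also have "\<dots> = ?N * (\<Sum>i<n. \<Sum>j<n. S $$ (i,j) * T $$ (i,j))" by (simp add: sum_distrib_left)
  \<comment> \<open>The double sum is the trace of \<open>S * ?U\<close>, hence that of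
    \<open>?U * S\<close>, the scalar matrix \<open>c\<close>.\<close>
  also have "(\<Sum>i<n. \<Sum>j<n. S $$ (i,j) * T $$ (i,j)) = mat_trace (S * ?U)"
    using S T by (simp add: mat_trace_def scalar_prod_def lessThan_atLeast0)
  also have "\<dots> = c * of_nat n"
    unfolding mat_trace_comm[OF S U] c by (simp add: mat_trace_def)
  finally have "frobenius_schur (rep_character G \<rho>) = c"
    using pos order_pos by (simp add: frobenius_schur_def)
  then show ?thesis using cc by simp
qed


section \<open>Completeness of the irreducible characters\<close>

lemma bij_conj: "h \<in> carrier G \<Longrightarrow> bij_betw (\<lambda>g. h \<otimes> g \<otimes> inv h) (carrier G) (carrier G)"
  by (intro bij_betwI[of _ _ _ "\<lambda>g. inv h \<otimes> g \<otimes> h"]) (auto simp: m_assoc simp flip: m_assoc[of "inv h" h] m_assoc[of h "inv h"])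

definition class_function :: "('a \<Rightarrow> complex) \<Rightarrow> bool" where
  "class_function f \<longleftrightarrow> (\<forall>g\<in>carrier G. \<forall>h\<in>carrier G. f (h \<otimes> g \<otimes> inv h) = f g)"

text \<open>The image under \<open>\<rho>\<close> of \<open>f\<close>, regarded as an element of the
  group algebra.\<close>

definition rep_sum :: "nat \<Rightarrow> ('a \<Rightarrow> complex mat) \<Rightarrow> ('a \<Rightarrow> complex) \<Rightarrow> complex mat" where
  "rep_sum n \<rho> f = mat_sum n n (carrier G) (\<lambda>g. f g \<cdot>\<^sub>m \<rho> g)"

lemma rep_sum_carrier [simp]: "rep_sum n \<rho> f \<in> carrier_mat n n"
  by (simp add: rep_sum_def)

text \<open>Substituting \<open>h \<otimes> g \<otimes> inv h\<close> for \<open>g\<close> carries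
  \<open>\<rho> h\<close> across the sum, and a class function does not see the
  substitution.\<close>

lemma rep_sum_commutes:
  assumes r: "is_rep G n \<rho>" and f: "class_function f" and h: "h \<in> carrier G"
  shows "\<rho> h * rep_sum n \<rho> f = rep_sum n \<rho> f * \<rho> h"
proof -
  note c = rep_carrier[OF r]
  let ?F = "\<lambda>g. f g \<cdot>\<^sub>m \<rho> g * \<rho> h"
  have t: "f g \<cdot>\<^sub>m \<rho> g \<in> carrier_mat n n" if "g \<in> carrier G" for g using c[OF that] by simp
  have "\<rho> h * rep_sum n \<rho> f = mat_sum n n (carrier G) (\<lambda>g. \<rho> h * (f g \<cdot>\<^sub>m \<rho> g))"
    unfolding rep_sum_def using c[OF h] t by (rule mult_mat_sum)
  also have "\<dots> = mat_sum n n (carrier G) (\<lambda>g. ?F (h \<otimes> g \<otimes> inv h))"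
  proof (rule mat_sum_cong)
    fix g assume g: "g \<in> carrier G"
    have k: "h \<otimes> g \<otimes> inv h \<in> carrier G" using g h by simp
    have "\<rho> (h \<otimes> g \<otimes> inv h) * \<rho> h = \<rho> (h \<otimes> g \<otimes> inv h \<otimes> h)" by (rule rep_mult[OF r k h, symmetric])
    also have "h \<otimes> g \<otimes> inv h \<otimes> h = h \<otimes> g" using g h by (simp add: m_assoc)
    also have "\<rho> (h \<otimes> g) = \<rho> h * \<rho> g" by (rule rep_mult[OF r h g])
    finally have "\<rho> (h \<otimes> g \<otimes> inv h) * \<rho> h = \<rho> h * \<rho> g" .
    moreover have "f (h \<otimes> g \<otimes> inv h) = f g" using f g h by (simp add: class_function_def)
    ultimately show "\<rho> h * (f g \<cdot>\<^sub>m \<rho> g) = ?F (h \<otimes> g \<otimes> inv h)"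
      using mult_smult_distrib[OF c[OF h] c[OF g]] mult_smult_assoc_mat[OF c[OF k] c[OF h]] by simp
  qed
  also have "\<dots> = mat_sum n n (carrier G) ?F" by (rule mat_sum_reindex[OF bij_conj[OF h]])
  also have "\<dots> = rep_sum n \<rho> f * \<rho> h"
    unfolding rep_sum_def using c[OF h] t by (rule mat_sum_mult[symmetric])
  finally show ?thesis .
qed

text \<open>By Schur's lemma the operator is a scalar, and its trace is the sum assumed to
  vanish.\<close>

lemma rep_sum_irreducible:
  assumes r: "irreducible_rep G n \<rho>" and f: "class_function f"
    and 0: "(\<Sum>g\<in>carrier G. f g * rep_character G \<rho> g) = 0"
  shows "rep_sum n \<rho> f = 0\<^sub>m n n"
proof -
  note rr = irreducible_rep_is_rep[OF r]
  obtain c where c: "rep_sum n \<rho> f = c \<cdot>\<^sub>m 1\<^sub>m n"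
    using schur_scalar[OF r rep_sum_carrier rep_sum_commutes[OF rr f]] by metis
  have "c * of_nat n = mat_trace (rep_sum n \<rho> f)" unfolding c by (simp add: mat_trace_def)
  also have "\<dots> = (\<Sum>g\<in>carrier G. mat_trace (f g \<cdot>\<^sub>m \<rho> g))"
    unfolding rep_sum_def by (rule mat_trace_mat_sum) (use rep_carrier[OF rr] in auto)
  also have "\<dots> = (\<Sum>g\<in>carrier G. f g * rep_character G \<rho> g)"
  proof (intro sum.cong refl)
    fix g assume g: "g \<in> carrier G"
    show "mat_trace (f g \<cdot>\<^sub>m \<rho> g) = f g * rep_character G \<rho> g"
      using rep_carrier[OF rr g] g by (simp add: rep_character_apply mat_trace_def sum_distrib_left)
  qed
  finally have "c = 0" using 0 irreducible_rep_pos[OF r] by simp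
  then show ?thesis unfolding c by (intro eq_matI) auto
qed

section \<open>The regular representation, by permutation matrices in a numbering \<open>e\<close>
  of the group\<close>

definition regular_rep :: "(nat \<Rightarrow> 'a) \<Rightarrow> 'a \<Rightarrow> complex mat" where
  "regular_rep e g = mat (Coset.order G) (Coset.order G) (\<lambda>(i,j). if e i = g \<otimes> e j then 1 else 0)"

lemma regular_rep_dim [simp]:
  "dim_row (regular_rep e g) = Coset.order G" "dim_col (regular_rep e g) = Coset.order G"
  by (simp_all add: regular_rep_def)

context
  fixes e :: "nat \<Rightarrow> 'a"
  assumes e: "bij_betw e {..<Coset.order G} (carrier G)"
begin

lemma e_carrier: "i < Coset.order G \<Longrightarrow> e i \<in> carrier G"
  using e by (auto simp: bij_betw_def)

lemma regular_rep_is_rep: "is_rep G (Coset.order G) (regular_rep e)"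
  unfolding is_rep_iff
proof (intro conjI ballI)
  let ?N = "Coset.order G"
  fix g h assume g: "g \<in> carrier G" and h: "h \<in> carrier G"
  show "regular_rep e (g \<otimes> h) = regular_rep e g * regular_rep e h"
  proof (rule eq_matI)
    fix i j assume "i < dim_row (regular_rep e g * regular_rep e h)" "j < dim_col (regular_rep e g * regular_rep e h)"
    then have ij: "i < ?N" "j < ?N" by (auto simp: regular_rep_def)
    have "(regular_rep e g * regular_rep e h) $$ (i,j) =
      (\<Sum>k<?N. if e k = h \<otimes> e j then (if e i = g \<otimes> e k then 1 else 0) else 0)"
      using ij by (auto simp: regular_rep_def scalar_prod_def lessThan_atLeast0 intro!: sum.cong)
    also have "\<dots> = (\<Sum>x\<in>carrier G. if x = h \<otimes> e j then (if e i = g \<otimes> x then 1 else 0) else 0)"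
      by (rule sum.reindex_bij_betw[OF e])
    also have "\<dots> = (if e i = g \<otimes> (h \<otimes> e j) then 1 else 0)"
      using fin h e_carrier[OF ij(2)] by simp
    also have "\<dots> = regular_rep e (g \<otimes> h) $$ (i,j)"
      using ij g h e_carrier by (simp add: regular_rep_def m_assoc)
    finally show "regular_rep e (g \<otimes> h) $$ (i,j) = (regular_rep e g * regular_rep e h) $$ (i,j)" by simp
  qed (auto simp: regular_rep_def)
next
  show "regular_rep e \<one> = 1\<^sub>m (Coset.order G)"
    using e e_carrier by (intro eq_matI) (auto simp: regular_rep_def bij_betw_def inj_on_def)
qed (auto simp: regular_rep_def)

text \<open>Permutation matrices are unitary.\<close>

lemma adjoint_regular_rep:
  assumes g: "g \<in> carrier G"
  shows "adjoint (regular_rep e g) = regular_rep e (inv g)"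
proof (rule eq_matI)
  fix i j assume "i < dim_row (regular_rep e (inv g))" "j < dim_col (regular_rep e (inv g))"
  then have ij: "i < Coset.order G" "j < Coset.order G" by (auto simp: regular_rep_def)
  have "e j = g \<otimes> e i \<longleftrightarrow> e i = inv g \<otimes> e j"
    using g e_carrier[OF ij(1)] e_carrier[OF ij(2)] inv_solve_left[of "e i" g "e j"] by auto
  then show "adjoint (regular_rep e g) $$ (i,j) = regular_rep e (inv g) $$ (i,j)"
    using ij by (simp add: adjoint_def regular_rep_def)
qed (auto simp: regular_rep_def adjoint_def)

text \<open>Makes the adjoint again the operator of a function, which is a class function whenever
  \<open>f\<close> is; hence it commutes with the representation and its range is invariant.\<close>

lemma adjoint_rep_sum_regular:
  "adjoint (rep_sum (Coset.order G) (regular_rep e) f) =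
    rep_sum (Coset.order G) (regular_rep e) (\<lambda>g. cnj (f (inv g)))"
proof -
  let ?N = "Coset.order G"
  have "adjoint (rep_sum ?N (regular_rep e) f) = mat_sum ?N ?N (carrier G) (\<lambda>g. cnj (f g) \<cdot>\<^sub>m regular_rep e (inv g))"
  proof (rule eq_matI)
    fix i j assume "i < dim_row (mat_sum ?N ?N (carrier G) (\<lambda>g. cnj (f g) \<cdot>\<^sub>m regular_rep e (inv g)))"
      "j < dim_col (mat_sum ?N ?N (carrier G) (\<lambda>g. cnj (f g) \<cdot>\<^sub>m regular_rep e (inv g)))"
    then have ij: "i < ?N" "j < ?N" by (auto simp: mat_sum_def)
    have "adjoint (rep_sum ?N (regular_rep e) f) $$ (i,j) = (\<Sum>g\<in>carrier G. cnj (f g * regular_rep e g $$ (j,i)))"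
      unfolding adjoint_index[OF rep_sum_carrier ij]
      using ij by (simp add: rep_sum_def mat_sum_index)
    also have "\<dots> = (\<Sum>g\<in>carrier G. cnj (f g) * regular_rep e (inv g) $$ (i,j))"
      using ij rep_carrier[OF regular_rep_is_rep]
      by (intro sum.cong refl) (simp add: adjoint_regular_rep[symmetric] adjoint_def)
    finally show "adjoint (rep_sum ?N (regular_rep e) f) $$ (i,j) =
      mat_sum ?N ?N (carrier G) (\<lambda>g. cnj (f g) \<cdot>\<^sub>m regular_rep e (inv g)) $$ (i,j)"
      using ij rep_carrier[OF regular_rep_is_rep] by (simp add: mat_sum_index)
  qed (auto simp: adjoint_def mat_sum_def rep_sum_def)
  also have "\<dots> = mat_sum ?N ?N (carrier G) (\<lambda>g. cnj (f (inv (inv g))) \<cdot>\<^sub>m regular_rep e (inv g))"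
    by (rule mat_sum_cong) simp
  also have "\<dots> = rep_sum ?N (regular_rep e) (\<lambda>g. cnj (f (inv g)))"
    unfolding rep_sum_def
    by (rule mat_sum_reindex[OF bij_inv, of ?N ?N "\<lambda>g. cnj (f (inv g)) \<cdot>\<^sub>m regular_rep e g"])
  finally show ?thesis .
qed

text \<open>If \<open>M \<noteq> 0\<close> is the operator of \<open>f\<close> on the regular representation, then the range of the adjoint
  of \<open>M\<close> contains an irreducible subrepresentation. \<open>M\<close> vanishes on it, but \<open>M\<close> is injective on that range.\<close>

lemma rep_sum_regular_eq_0:
  assumes f: "class_function f"
    and 0: "\<And>n \<rho>. irreducible_rep G n \<rho> \<Longrightarrow> (\<Sum>g\<in>carrier G. f g * rep_character G \<rho> g) = 0"
  shows "rep_sum (Coset.order G) (regular_rep e) f = 0\<^sub>m (Coset.order G) (Coset.order G)"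
proof (rule ccontr)
  let ?N = "Coset.order G" and ?L = "regular_rep e"
  define M where "M = rep_sum ?N ?L f"
  assume "rep_sum ?N ?L f \<noteq> 0\<^sub>m ?N ?N"
  then have nz: "M \<noteq> 0\<^sub>m ?N ?N" by (simp add: M_def)
  have M: "M \<in> carrier_mat ?N ?N" by (simp add: M_def)
  define F where "F = adjoint M"
  have F: "F \<in> carrier_mat ?N ?N" and aF: "adjoint F = M" using M by (auto simp: F_def)
  have f': "class_function (\<lambda>g. cnj (f (inv g)))"
    using f by (auto simp: class_function_def inv_mult_group simp flip: m_assoc)
  note L = rep_carrier[OF regular_rep_is_rep]
  have FL: "?L g * F = F * ?L g" if "g \<in> carrier G" for g
    unfolding F_def M_def adjoint_rep_sum_regular by (rule rep_sum_commutes[OF regular_rep_is_rep f' that])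
  let ?W = "(*\<^sub>v) F ` carrier_vec ?N"
  have inv: "invariant_subspace G ?N ?L ?W"
    unfolding invariant_subspace_def
  proof (intro conjI ballI)
    fix g w assume g: "g \<in> carrier G" and "w \<in> ?W"
    then obtain v where v: "v \<in> carrier_vec ?N" "w = F *\<^sub>v v" by blast
    then have "?L g *\<^sub>v w = F *\<^sub>v (?L g *\<^sub>v v)"
      using assoc_mult_mat_vec[OF L[OF g] F v(1)] assoc_mult_mat_vec[OF F L[OF g] v(1)] FL[OF g] by simp
    then show "?L g *\<^sub>v w \<in> ?W" using L[OF g] v by auto
  qed (rule range_mat_subspace[OF F])
  obtain d E \<rho>' where E: "E \<in> carrier_mat ?N d" "inj_mat E" "?W = (*\<^sub>v) E ` carrier_vec d"
    and r': "is_rep G d \<rho>'" and i: "\<And>g. g \<in> carrier G \<Longrightarrow> ?L g * E = E * \<rho>' g"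
    using invariant_subspace_rep[OF regular_rep_is_rep inv] by metis
  have "d > 0"
  proof (rule ccontr)
    assume "\<not> d > 0"
    then have "E *\<^sub>v v = 0\<^sub>v ?N" if "v \<in> carrier_vec d" for v
      using that E(1) by (intro eq_vecI) (auto simp: scalar_prod_def)
    then have W0: "?W = {0\<^sub>v ?N}" unfolding E(3) by (rule zero_mat_range)
    have "F = 0\<^sub>m ?N ?N"
    proof (rule mat_col_eqI)
      fix j assume "j < dim_col (0\<^sub>m ?N ?N :: complex mat)"
      then have j: "j < ?N" by simp
      have "F *\<^sub>v unit_vec ?N j \<in> ?W" by simp
      then show "col F j = col (0\<^sub>m ?N ?N) j" unfolding W0 using mult_mat_unit_vec[OF F j] j by simp
    qed (use F in auto)
    then show False using nz aF by auto
  qed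
  then obtain k D \<rho>'' where r'': "irreducible_rep G k \<rho>''" and D: "D \<in> carrier_mat d k" "inj_mat D"
    and i': "\<And>g. g \<in> carrier G \<Longrightarrow> \<rho>' g * D = D * \<rho>'' g"
    using irreducible_subrep[OF r'] by metis
  note c'' = rep_carrier[OF irreducible_rep_is_rep[OF r'']]
  define B where "B = E * D"
  have B: "B \<in> carrier_mat ?N k" "inj_mat B"
    unfolding B_def using E D inj_mat_mult[OF E(1) D(1)] by auto
  have iB: "?L g * B = B * \<rho>'' g" if g: "g \<in> carrier G" for g
  proof -
    have "?L g * (E * D) = ?L g * E * D" by (rule assoc_mult_mat[OF L[OF g] E(1) D(1), symmetric])
    also have "\<dots> = E * (\<rho>' g * D)" unfolding i[OF g] by (rule assoc_mult_mat[OF E(1) rep_carrier[OF r' g] D(1)])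
    also have "\<dots> = E * D * \<rho>'' g" unfolding i'[OF g] by (rule assoc_mult_mat[OF E(1) D(1) c''[OF g], symmetric])
    finally show ?thesis unfolding B_def .
  qed
  \<comment> \<open>On the range of \<open>B\<close> the operator \<open>M\<close> acts as the
    operator of \<open>f\<close> on the irreducible \<open>\<rho>''\<close>, which is zero.\<close>
  have "M * B = mat_sum ?N k (carrier G) (\<lambda>g. f g \<cdot>\<^sub>m ?L g * B)"
    unfolding M_def rep_sum_def by (rule mat_sum_mult[OF B(1)]) (use L in auto)
  also have "\<dots> = mat_sum ?N k (carrier G) (\<lambda>g. B * (f g \<cdot>\<^sub>m \<rho>'' g))"
    by (rule mat_sum_cong)
      (simp add: mult_smult_assoc_mat[OF L B(1)] mult_smult_distrib[OF B(1) c''] iB)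
  also have "\<dots> = B * rep_sum k \<rho>'' f"
    unfolding rep_sum_def by (rule mult_mat_sum[OF B(1), symmetric]) (use c'' in auto)
  also have "\<dots> = 0\<^sub>m ?N k"
    unfolding rep_sum_irreducible[OF r'' f 0[OF r'']] using B by simp
  finally have MB: "M * B = 0\<^sub>m ?N k" .
  let ?u = "unit_vec k 0 :: complex vec"
  have k: "k > 0" by (rule irreducible_rep_pos[OF r''])
  have "B *\<^sub>v ?u = E *\<^sub>v (D *\<^sub>v ?u)"
    unfolding B_def using E(1) D(1) by (intro assoc_mult_mat_vec) auto
  moreover have "D *\<^sub>v ?u \<in> carrier_vec d" using D by auto
  ultimately have "B *\<^sub>v ?u \<in> ?W" unfolding E(3) by simp
  \<comment> \<open>The vector is in the range of \<open>F\<close> and is killed by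
    \<open>M\<close>, the adjoint of \<open>F\<close>. So \<open>adjoint_ker\<close> makes it zero,
    against the injectivity of \<open>B\<close>.\<close>
  then obtain v where v: "v \<in> carrier_vec ?N" "B *\<^sub>v ?u = F *\<^sub>v v" by blast
  have "M *\<^sub>v (F *\<^sub>v v) = M * B *\<^sub>v ?u"
    unfolding v(2)[symmetric] by (rule assoc_mult_mat_vec[OF M B(1), symmetric]) simp
  also have "\<dots> = 0\<^sub>v ?N" unfolding MB by (intro eq_vecI) auto
  finally have "F *\<^sub>v v = 0\<^sub>v ?N" using adjoint_ker[OF F v(1)] aF by simp
  then have "?u = 0\<^sub>v k" using inj_matD[OF B(2,1), of ?u] v by simp
  then have "?u $ 0 = (0\<^sub>v k :: complex vec) $ 0" by simp
  then show False using k by simp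
qed

end

text \<open>In the regular representation the column belonging to \<open>\<one>\<close> of the
  operator of \<open>f\<close> lists the values of \<open>f\<close>.\<close>

lemma class_function_eq_0:
  assumes f: "class_function f"
    and 0: "\<And>n \<rho>. irreducible_rep G n \<rho> \<Longrightarrow> (\<Sum>g\<in>carrier G. f g * rep_character G \<rho> g) = 0"
    and g: "g \<in> carrier G"
  shows "f g = 0"
proof -
  let ?N = "Coset.order G"
  obtain e where e: "bij_betw e {..<?N} (carrier G)"
    using ex_bij_betw_nat_finite[OF fin] by (auto simp: Coset.order_def lessThan_atLeast0)
  then obtain i j where ij: "i < ?N" "e i = g" "j < ?N" "e j = \<one>"
    using g one_closed unfolding bij_betw_def by (metis (no_types, lifting) imageE lessThan_iff)
  have "0 = rep_sum ?N (regular_rep e) f $$ (i,j)"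
    using rep_sum_regular_eq_0[OF e f 0] ij by simp
  also have "\<dots> = (\<Sum>h\<in>carrier G. if g = h then f h else 0)"
    using ij by (auto simp: rep_sum_def mat_sum_index regular_rep_def intro!: sum.cong)
  also have "\<dots> = f g" using fin g by simp
  finally show ?thesis by simp
qed

section \<open>Orthonormality, finiteness and expansion in irreducible characters\<close>

lemma group_inner_cong:
  "(\<And>g. g \<in> carrier G \<Longrightarrow> F g = F' g) \<Longrightarrow> (\<And>g. g \<in> carrier G \<Longrightarrow> H g = H' g) \<Longrightarrow>
    group_inner G F H = group_inner G F' H'"
  by (simp add: group_inner_def)

lemma group_inner_self:
  "group_inner G F F = of_real ((\<Sum>g\<in>carrier G. (cmod (F g))\<^sup>2) / real (Coset.order G))"
  by (simp add: group_inner_def complex_norm_square del: of_real_power)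

lemma group_inner_sum_left:
  "group_inner G (\<lambda>g. \<Sum>i\<in>I. a i * F i g) H = (\<Sum>i\<in>I. a i * group_inner G (F i) H)"
  by (simp add: group_inner_def sum_distrib_left sum_distrib_right mult_ac sum.swap[of _ I])

lemma group_inner_cnj: "cnj (group_inner G F H) = group_inner G H F"
  by (simp add: group_inner_def mult.commute)

lemma group_inner_diff_left:
  "group_inner G (\<lambda>g. F g - F' g) H = group_inner G F H - group_inner G F' H"
  by (simp add: group_inner_def left_diff_distrib sum_subtractf right_diff_distrib)

lemma class_functionD:
  "class_function f \<Longrightarrow> g \<in> carrier G \<Longrightarrow> h \<in> carrier G \<Longrightarrow> f (h \<otimes> g \<otimes> inv h) = f g"
  by (simp add: class_function_def)

lemma irreducible_charactersE:
  assumes "\<chi> \<in> irreducible_characters G"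
  obtains n \<rho> where "irreducible_rep G n \<rho>" "\<chi> = rep_character G \<rho>" "\<chi> \<one> = of_nat n" "n > 0"
    "char_degree G \<chi> = real n"
proof -
  obtain n \<rho> where *: "irreducible_rep G n \<rho>" "\<chi> = rep_character G \<rho>"
    using assms by (auto simp: irreducible_characters_def)
  moreover have "\<chi> \<one> = of_nat n" using * rep_character_one irreducible_rep_is_rep by blast
  ultimately show ?thesis using irreducible_rep_pos that by (auto simp: char_degree_def)
qed

lemma irreducible_character_one:
  "\<chi> \<in> irreducible_characters G \<Longrightarrow> \<chi> \<one> = complex_of_real (char_degree G \<chi>)"
  by (erule irreducible_charactersE) simp

lemma char_degree_ge_1: "\<chi> \<in> irreducible_characters G \<Longrightarrow> char_degree G \<chi> \<ge> 1"
  by (erule irreducible_charactersE) simp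

lemma class_function_irreducible_character:
  "\<chi> \<in> irreducible_characters G \<Longrightarrow> class_function \<chi>"
  by (erule irreducible_charactersE)
    (auto simp: class_function_def intro: rep_character_conj_class[OF irreducible_rep_is_rep])

lemma irreducible_character_inv:
  "\<chi> \<in> irreducible_characters G \<Longrightarrow> g \<in> carrier G \<Longrightarrow> \<chi> (inv g) = cnj (\<chi> g)"
  by (erule irreducible_charactersE) (auto simp: rep_character_inv)

lemma convolution_irreducible_characters:
  assumes "\<chi> \<in> irreducible_characters G" "\<psi> \<in> irreducible_characters G" "h \<in> carrier G"
  shows "convolution G \<chi> \<psi> h =
    (if \<chi> = \<psi> then of_nat (Coset.order G) / of_real (char_degree G \<chi>) * \<chi> h else 0)"
proof -
  obtain n \<rho> where 1: "irreducible_rep G n \<rho>" "\<chi> = rep_character G \<rho>" "char_degree G \<chi> = real n"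
    using assms(1) by (elim irreducible_charactersE)
  obtain m \<rho>' where 2: "irreducible_rep G m \<rho>'" "\<psi> = rep_character G \<rho>'"
    using assms(2) by (elim irreducible_charactersE)
  show ?thesis
    using convolution_character_same[OF 1(1) assms(3)] convolution_character_distinct[OF 1(1) 2(1) assms(3)] 1 2
    by auto
qed

text \<open>Since \<open>cnj (\<psi> g) = \<psi> (inv g)\<close>, the inner product is, up to the
  group order, the convolution at \<open>\<one>\<close>.\<close>

lemma irreducible_characters_orthonormal:
  assumes "\<chi> \<in> irreducible_characters G" "\<psi> \<in> irreducible_characters G"
  shows "group_inner G \<chi> \<psi> = (if \<chi> = \<psi> then 1 else 0)"
proof -
  have "(\<Sum>g\<in>carrier G. \<chi> g * cnj (\<psi> g)) = convolution G \<chi> \<psi> \<one>"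
    unfolding convolution_def by (intro sum.cong refl) (simp add: irreducible_character_inv[OF assms(2)])
  then show ?thesis
    using convolution_irreducible_characters[OF assms one_closed] irreducible_character_one[OF assms(1)]
      char_degree_ge_1[OF assms(1)] order_pos
    by (auto simp: group_inner_def)
qed

lemma group_inner_combination:
  assumes "finite I" "I \<subseteq> irreducible_characters G"
  shows "group_inner G (\<lambda>g. \<Sum>\<chi>\<in>I. a \<chi> * \<chi> g) (\<lambda>g. \<Sum>\<chi>\<in>I. a \<chi> * \<chi> g) = (\<Sum>\<chi>\<in>I. a \<chi> * cnj (a \<chi>))"
proof -
  have "group_inner G \<chi> (\<lambda>g. \<Sum>\<psi>\<in>I. a \<psi> * \<psi> g) = cnj (a \<chi>)" if \<chi>: "\<chi> \<in> I" for \<chi>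
  proof -
    have "group_inner G \<chi> (\<lambda>g. \<Sum>\<psi>\<in>I. a \<psi> * \<psi> g) = cnj (\<Sum>\<psi>\<in>I. a \<psi> * group_inner G \<psi> \<chi>)"
      unfolding group_inner_sum_left[symmetric] group_inner_cnj ..
    also have "(\<Sum>\<psi>\<in>I. a \<psi> * group_inner G \<psi> \<chi>) = (\<Sum>\<psi>\<in>I. if \<psi> = \<chi> then a \<psi> else 0)"
      using assms \<chi> by (intro sum.cong refl) (auto simp: irreducible_characters_orthonormal subset_iff)
    also have "\<dots> = a \<chi>" using assms \<chi> by simp
    finally show ?thesis .
  qed
  then show ?thesis by (simp add: group_inner_sum_left)
qed

text \<open>Bessel's inequality for the indicator function of \<open>\<one>\<close>: its squared
  norm is \<open>1 / |G|\<close>, its coefficient at \<open>\<chi>\<close> is \<open>d / |G|\<close>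
  with \<open>d \<ge> 1\<close>. This yields finiteness of the set of irreducible characters, before
  which a sum over it could be 0 by default.\<close>

lemma card_irreducible_characters_bound:
  assumes I: "finite I" "I \<subseteq> irreducible_characters G"
  shows "card I \<le> Coset.order G"
proof -
  let ?N = "of_nat (Coset.order G) :: complex" and ?\<delta> = "\<lambda>g. if g = \<one> then 1 else 0 :: complex"
  define a where "a \<chi> = group_inner G ?\<delta> \<chi>" for \<chi>
  have a: "a \<chi> = of_real (char_degree G \<chi> / real (Coset.order G))" if "\<chi> \<in> I" for \<chi>
  proof -
    have "\<chi> \<one> = of_real (char_degree G \<chi>)" using irreducible_character_one I that by blast
    then show ?thesis
      using fin by (simp add: a_def group_inner_def if_distrib[of "\<lambda>x. x * _"] cong: if_cong)
  qed
  let ?D = "\<lambda>g. ?\<delta> g - (\<Sum>\<chi>\<in>I. a \<chi> * \<chi> g)"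
  \<comment> \<open>Pythagoras: the projection onto the span of \<open>I\<close> is orthogonal to
    the remainder \<open>?D\<close>.\<close>
  have split: "group_inner G ?D ?D = group_inner G ?\<delta> ?\<delta> - (\<Sum>\<chi>\<in>I. a \<chi> * cnj (a \<chi>))"
  proof -
    let ?P = "\<lambda>g. \<Sum>\<chi>\<in>I. a \<chi> * \<chi> g"
    have P\<delta>: "group_inner G ?P ?\<delta> = (\<Sum>\<chi>\<in>I. a \<chi> * cnj (a \<chi>))"
      unfolding group_inner_sum_left a_def group_inner_cnj ..
    have \<delta>P: "group_inner G ?\<delta> ?P = (\<Sum>\<chi>\<in>I. a \<chi> * cnj (a \<chi>))"
      using arg_cong[OF P\<delta>, of cnj] by (simp add: group_inner_cnj mult.commute)
    have "group_inner G ?D ?D = group_inner G ?\<delta> ?D - group_inner G ?P ?D"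
      by (rule group_inner_diff_left)
    also have "group_inner G ?\<delta> ?D = cnj (group_inner G ?\<delta> ?\<delta> - group_inner G ?P ?\<delta>)"
      unfolding group_inner_diff_left[symmetric] group_inner_cnj ..
    also have "group_inner G ?P ?D = cnj (group_inner G ?\<delta> ?P - group_inner G ?P ?P)"
      unfolding group_inner_diff_left[symmetric] group_inner_cnj ..
    also have "group_inner G ?\<delta> ?P - group_inner G ?P ?P = 0"
      using group_inner_combination[OF I] \<delta>P by simp
    also have "cnj (group_inner G ?\<delta> ?\<delta> - group_inner G ?P ?\<delta>) =
      group_inner G ?\<delta> ?\<delta> - (\<Sum>\<chi>\<in>I. a \<chi> * cnj (a \<chi>))"
      unfolding complex_cnj_diff group_inner_cnj \<delta>P ..
    finally show ?thesis by simp
  qed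
  have "0 \<le> Re (group_inner G ?D ?D)"
    by (simp add: group_inner_self sum_nonneg)
  also have "group_inner G ?\<delta> ?\<delta> = 1 / ?N"
    using fin by (simp add: group_inner_def if_distrib[of "\<lambda>x. x * _"] cong: if_cong)
  then have "group_inner G ?D ?D = of_real (1 / real (Coset.order G) - (\<Sum>\<chi>\<in>I. (char_degree G \<chi> / real (Coset.order G))\<^sup>2))"
    unfolding split by (simp add: a power2_eq_square)
  finally have le: "(\<Sum>\<chi>\<in>I. (char_degree G \<chi> / real (Coset.order G))\<^sup>2) \<le> 1 / real (Coset.order G)"
    by simp
  have "(\<Sum>\<chi>\<in>I. (1 / real (Coset.order G))\<^sup>2) \<le> (\<Sum>\<chi>\<in>I. (char_degree G \<chi> / real (Coset.order G))\<^sup>2)"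
  proof (intro sum_mono power_mono divide_right_mono)
    fix \<chi> assume "\<chi> \<in> I" then show "1 \<le> char_degree G \<chi>" using char_degree_ge_1 I by blast
  qed auto
  with le have "real (card I) * (1 / real (Coset.order G))\<^sup>2 \<le> 1 / real (Coset.order G)" by simp
  then show ?thesis using order_pos by (simp add: field_simps power2_eq_square)
qed

lemma finite_irreducible_characters: "finite (irreducible_characters G)"
proof (rule ccontr)
  assume "infinite (irreducible_characters G)"
  then obtain I where "I \<subseteq> irreducible_characters G" "finite I" "card I = Suc (Coset.order G)"
    using infinite_arbitrarily_large by blast
  then show False using card_irreducible_characters_bound[of I] by simp
qed

text \<open>Mediates between the bilinear pairing in the completeness criterion and the inner
  product, which conjugates its second argument.\<close>

lemma conj_irreducible_character:
  assumes r: "irreducible_rep G n \<rho>"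
  shows "\<exists>\<chi>\<in>irreducible_characters G. \<forall>g\<in>carrier G. \<chi> g = cnj (rep_character G \<rho> g)"
proof (intro bexI ballI)
  let ?\<rho> = "\<lambda>g. transpose_mat (\<rho> (inv g))"
  show "rep_character G ?\<rho> \<in> irreducible_characters G"
    using transpose_dual_irreducible[OF r] unfolding irreducible_characters_def by blast
  show "rep_character G ?\<rho> g = cnj (rep_character G \<rho> g)" if "g \<in> carrier G" for g
    using transpose_dual_character[OF irreducible_rep_is_rep[OF r] that] rep_character_inv[OF r that] by simp
qed

text \<open>The difference of the two sides is a class function orthogonal to every irreducible
  character, hence zero by completeness.\<close>

lemma class_function_expansion:
  assumes f: "class_function f" and g: "g \<in> carrier G"
  shows "f g = (\<Sum>\<chi>\<in>irreducible_characters G. group_inner G f \<chi> * \<chi> g)"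
proof -
  let ?P = "\<lambda>g. \<Sum>\<chi>\<in>irreducible_characters G. group_inner G f \<chi> * \<chi> g"
  let ?D = "\<lambda>g. f g - ?P g"
  have "class_function ?D"
    unfolding class_function_def
    by (intro ballI arg_cong2[of _ _ _ _ "(-)"] sum.cong arg_cong2[of _ _ _ _ "(*)"] refl
        class_functionD[OF f] class_functionD[OF class_function_irreducible_character])
  moreover have "(\<Sum>g\<in>carrier G. ?D g * rep_character G \<rho> g) = 0" if r: "irreducible_rep G n \<rho>" for n \<rho>
  proof -
    obtain \<psi> where \<psi>: "\<psi> \<in> irreducible_characters G" "\<And>g. g \<in> carrier G \<Longrightarrow> \<psi> g = cnj (rep_character G \<rho> g)"
      using conj_irreducible_character[OF r] by blast
    have "group_inner G ?P \<psi> = (\<Sum>\<chi>\<in>irreducible_characters G. if \<chi> = \<psi> then group_inner G f \<chi> else 0)"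
      unfolding group_inner_sum_left
      using irreducible_characters_orthonormal[OF _ \<psi>(1)] by (intro sum.cong refl) auto
    then have "group_inner G ?D \<psi> = 0"
      using \<psi>(1) finite_irreducible_characters by (simp add: group_inner_diff_left)
    then show ?thesis using order_pos \<psi>(2) by (simp add: group_inner_def)
  qed
  ultimately have "?D g = 0" using g by (rule class_function_eq_0)
  then show ?thesis by simp
qed


section \<open>Convolution powers of the square distribution\<close>

lemma pow2_eq: "x \<in> carrier G \<Longrightarrow> x [^] (2::nat) = x \<otimes> x"
  by (simp add: numeral_2_eq_2)

lemma conj_square:
  assumes "x \<in> carrier G" "h \<in> carrier G"
  shows "(h \<otimes> x \<otimes> inv h) \<otimes> (h \<otimes> x \<otimes> inv h) = h \<otimes> (x \<otimes> x) \<otimes> inv h"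
proof -
  have "inv h \<otimes> (h \<otimes> (x \<otimes> inv h)) = x \<otimes> inv h" using assms by (simp flip: m_assoc)
  then show ?thesis using assms by (simp add: m_assoc)
qed

text \<open>Conjugation by \<open>h\<close> maps the square roots of \<open>g\<close> bijectively to
  those of \<open>h \<otimes> g \<otimes> inv h\<close>.\<close>

lemma class_function_num_square_roots: "class_function (\<lambda>g. of_nat (num_square_roots G g))"
proof -
  have "num_square_roots G (h \<otimes> g \<otimes> inv h) = num_square_roots G g"
    if g: "g \<in> carrier G" and h: "h \<in> carrier G" for g h
  proof -
    have bij: "bij_betw (\<lambda>x. h \<otimes> x \<otimes> inv h) {x \<in> carrier G. x [^] (2::nat) = g}
      {x \<in> carrier G. x [^] (2::nat) = h \<otimes> g \<otimes> inv h}"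
    proof (rule bij_betw_imageI)
      show "inj_on (\<lambda>x. h \<otimes> x \<otimes> inv h) {x \<in> carrier G. x [^] (2::nat) = g}"
        using bij_conj[OF h] unfolding bij_betw_def by (rule_tac inj_on_subset) auto
      have "(h \<otimes> x \<otimes> inv h) [^] (2::nat) = h \<otimes> g \<otimes> inv h \<longleftrightarrow> x [^] (2::nat) = g" if x: "x \<in> carrier G" for x
        using x g h by (simp add: pow2_eq conj_square)
      then show "(\<lambda>x. h \<otimes> x \<otimes> inv h) ` {x \<in> carrier G. x [^] (2::nat) = g} =
          {x \<in> carrier G. x [^] (2::nat) = h \<otimes> g \<otimes> inv h}"
        using bij_conj[OF h] unfolding bij_betw_def by (auto simp: set_eq_iff image_iff) metis
    qed
    show ?thesis unfolding num_square_roots_def using bij_betw_same_card[OF bij] by simp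
  qed
  then show ?thesis by (simp add: class_function_def)
qed

lemma
  assumes "\<chi> \<in> irreducible_characters G"
  shows frobenius_schur_square: "\<forall>g\<in>carrier G. \<chi> g \<in> \<real> \<Longrightarrow> (frobenius_schur \<chi>)\<^sup>2 = 1"
    and frobenius_schur_eq_0: "\<not> (\<forall>g\<in>carrier G. \<chi> g \<in> \<real>) \<Longrightarrow> frobenius_schur \<chi> = 0"
  using assms frobenius_schur_real frobenius_schur_nonreal by (elim irreducible_charactersE, blast)+

text \<open>The indicator only takes the values 0, 1 and -1.\<close>

lemma cnj_frobenius_schur:
  assumes "\<chi> \<in> irreducible_characters G"
  shows "cnj (frobenius_schur \<chi>) = frobenius_schur \<chi>"
  using frobenius_schur_square[OF assms] frobenius_schur_eq_0[OF assms]
  by (cases "\<forall>g\<in>carrier G. \<chi> g \<in> \<real>") (auto simp: power2_eq_1_iff)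

text \<open>Grouping the elements \<open>h\<close> by their square turns the sum weighted by
  \<open>r\<close> into the sum of \<open>cnj (\<chi> (h \<otimes> h))\<close> over the group. This
  is the conjugate of the indicator, which is real.\<close>

lemma group_inner_num_square_roots:
  assumes \<chi>: "\<chi> \<in> irreducible_characters G"
  shows "group_inner G (\<lambda>g. of_nat (num_square_roots G g)) \<chi> = frobenius_schur \<chi>"
proof -
  have "(\<Sum>g\<in>carrier G. of_nat (num_square_roots G g) * cnj (\<chi> g)) =
    (\<Sum>g\<in>carrier G. \<Sum>h\<in>{h \<in> carrier G. h \<otimes> h = g}. cnj (\<chi> (h \<otimes> h)))"
  proof (intro sum.cong refl)
    fix g
    have "{h \<in> carrier G. h [^] (2::nat) = g} = {h \<in> carrier G. h \<otimes> h = g}" by (auto simp: pow2_eq)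
    then show "of_nat (num_square_roots G g) * cnj (\<chi> g) =
      (\<Sum>h\<in>{h \<in> carrier G. h \<otimes> h = g}. cnj (\<chi> (h \<otimes> h)))"
      by (simp add: num_square_roots_def)
  qed
  also have "\<dots> = (\<Sum>h\<in>carrier G. cnj (\<chi> (h \<otimes> h)))"
    using fin by (intro sum.group) auto
  finally have "group_inner G (\<lambda>g. of_nat (num_square_roots G g)) \<chi> = cnj (frobenius_schur \<chi>)"
    by (simp add: group_inner_def frobenius_schur_def)
  then show ?thesis using cnj_frobenius_schur[OF \<chi>] by simp
qed

lemma square_prob_expansion:
  assumes "g \<in> carrier G"
  shows "square_prob G g = (\<Sum>\<chi>\<in>irreducible_characters G. frobenius_schur \<chi> / of_nat (Coset.order G) * \<chi> g)"
  using class_function_expansion[OF class_function_num_square_roots assms] group_inner_num_square_roots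
  by (simp add: square_prob_def sum_divide_distrib)

lemma convolution_cong:
  assumes "\<And>g. g \<in> carrier G \<Longrightarrow> P g = P' g" "\<And>g. g \<in> carrier G \<Longrightarrow> Q g = Q' g" "h \<in> carrier G"
  shows "convolution G P Q h = convolution G P' Q' h"
  using assms by (simp add: convolution_def)

lemma convolution_combinations:
  assumes h: "h \<in> carrier G"
  shows "convolution G (\<lambda>g. \<Sum>\<chi>\<in>irreducible_characters G. a \<chi> * \<chi> g)
      (\<lambda>g. \<Sum>\<chi>\<in>irreducible_characters G. b \<chi> * \<chi> g) h =
    (\<Sum>\<chi>\<in>irreducible_characters G. a \<chi> * b \<chi> * (of_nat (Coset.order G) / of_real (char_degree G \<chi>)) * \<chi> h)"
    (is "convolution G ?A ?B h = _")
proof -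
  let ?I = "irreducible_characters G"
  have "convolution G ?A ?B h =
    (\<Sum>g\<in>carrier G. \<Sum>\<chi>\<in>?I. \<Sum>\<psi>\<in>?I. a \<chi> * b \<psi> * (\<chi> g * \<psi> (inv g \<otimes> h)))"
    by (simp add: convolution_def sum_product mult_ac)
  also have "\<dots> = (\<Sum>\<chi>\<in>?I. \<Sum>\<psi>\<in>?I. a \<chi> * b \<psi> * convolution G \<chi> \<psi> h)"
    by (simp only: sum.swap[of _ "carrier G"] convolution_def sum_distrib_left)
  also have "\<dots> = (\<Sum>\<chi>\<in>?I. \<Sum>\<psi>\<in>?I. if \<psi> = \<chi> then
      a \<chi> * b \<chi> * (of_nat (Coset.order G) / of_real (char_degree G \<chi>)) * \<chi> h else 0)"
    by (intro sum.cong refl) (auto simp: convolution_irreducible_characters[OF _ _ h])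
  finally show ?thesis using finite_irreducible_characters by simp
qed

text \<open>\<open>Suc k\<close> factors mean \<open>k\<close> convolutions. Each multiplies the
  coefficient by the indicator over \<open>|G|\<close> and by \<open>|G| / d\<close>, so the group
  order remains once and the degree gets the exponent \<open>k\<close>.\<close>

lemma conv_power_expansion:
  assumes "h \<in> carrier G"
  shows "conv_power G (square_prob G) (Suc k) h = (\<Sum>\<chi>\<in>irreducible_characters G.
    frobenius_schur \<chi> ^ Suc k / (of_nat (Coset.order G) * of_real (char_degree G \<chi>) ^ k) * \<chi> h)"
  using assms
proof (induction k arbitrary: h)
  case 0
  then show ?case using square_prob_expansion by (simp add: conv_power_def)
next
  case (Suc k)
  have "conv_power G (square_prob G) (Suc (Suc k)) h =
    convolution G (square_prob G) (conv_power G (square_prob G) (Suc k)) h"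
    by (simp add: conv_power_def)
  also have "\<dots> = convolution G
      (\<lambda>g. \<Sum>\<chi>\<in>irreducible_characters G. frobenius_schur \<chi> / of_nat (Coset.order G) * \<chi> g)
      (\<lambda>g. \<Sum>\<chi>\<in>irreducible_characters G.
        frobenius_schur \<chi> ^ Suc k / (of_nat (Coset.order G) * of_real (char_degree G \<chi>) ^ k) * \<chi> g) h"
    using square_prob_expansion Suc.IH Suc.prems by (rule convolution_cong)
  also have "\<dots> = (\<Sum>\<chi>\<in>irreducible_characters G.
    frobenius_schur \<chi> ^ Suc (Suc k) / (of_nat (Coset.order G) * of_real (char_degree G \<chi>) ^ Suc k) * \<chi> h)"
    unfolding convolution_combinations[OF Suc.prems]
    using order_pos by (intro sum.cong refl) (simp add: field_simps)
  finally show ?case .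
qed

section \<open>The principal character and the norm\<close>

lemma irreducible_trivial_rep: "irreducible_rep G 1 (\<lambda>_. 1\<^sub>m 1)"
  unfolding irreducible_rep_def
proof (intro conjI allI impI)
  show "is_rep G 1 (\<lambda>_. 1\<^sub>m 1)" by (simp add: is_rep_iff)
  fix W assume "invariant_subspace G 1 (\<lambda>_. 1\<^sub>m 1) W"
  then have W: "W \<subseteq> carrier_vec 1" "0\<^sub>v 1 \<in> W" "\<And>c v. v \<in> W \<Longrightarrow> c \<cdot>\<^sub>v v \<in> W"
    by (simp_all add: invariant_subspace_def subspace_vec_iff)
  show "W = {0\<^sub>v 1} \<or> W = carrier_vec 1"
  proof (cases "W = {0\<^sub>v 1}")
    case False
    then obtain w where w: "w \<in> W" "w \<noteq> 0\<^sub>v 1" using W(2) by blast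
    then have wc: "w \<in> carrier_vec 1" using W by blast
    have w0: "w $ 0 \<noteq> 0"
    proof
      assume "w $ 0 = 0"
      then have "w = 0\<^sub>v 1" using wc by (intro eq_vecI) auto
      with w show False by simp
    qed
    have "v \<in> W" if v: "v \<in> carrier_vec 1" for v
    proof -
      \<comment> \<open>In dimension one a nonzero vector rescales to every other.\<close>
      have "v = (v $ 0 / w $ 0) \<cdot>\<^sub>v w" using v wc w0 by (intro eq_vecI) auto
      then show ?thesis using W(3)[OF w(1)] by metis
    qed
    then show ?thesis using W by blast
  qed simp
qed simp

lemma principal_character_eq: "principal_character G = rep_character G (\<lambda>_. 1\<^sub>m 1)"
  by (simp add: principal_character_def rep_character_def mat_trace_one)

lemma principal_character_irreducible: "principal_character G \<in> irreducible_characters G"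
  unfolding principal_character_eq irreducible_characters_def using irreducible_trivial_rep by blast

lemma frobenius_schur_principal: "frobenius_schur (principal_character G) = 1"
  using order_pos by (simp add: frobenius_schur_def principal_character_def Coset.order_def)

lemma char_degree_principal: "char_degree G (principal_character G) = 1"
  by (simp add: char_degree_def principal_character_def)

lemma group_norm_conv_power:
  "group_norm G (\<lambda>g. conv_power G (square_prob G) (Suc k) g - uniform_prob G g) =
    1 / real (Coset.order G) *
      sqrt (\<Sum>\<chi>\<in>real_irreducible_characters G. char_degree G \<chi> powi (2 * (- int (Suc k) + 1)))"
proof -
  let ?I = "irreducible_characters G" and ?N = "real (Coset.order G)" and ?p = "principal_character G"
  define c where "c \<chi> = frobenius_schur \<chi> ^ Suc k / (of_nat (Coset.order G) * of_real (char_degree G \<chi>) ^ k)" for \<chi>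
  let ?F = "\<lambda>g. conv_power G (square_prob G) (Suc k) g - uniform_prob G g"
  have F: "?F g = (\<Sum>\<chi>\<in>?I - {?p}. c \<chi> * \<chi> g)" if g: "g \<in> carrier G" for g
  proof -
    have "conv_power G (square_prob G) (Suc k) g = (\<Sum>\<chi>\<in>?I. c \<chi> * \<chi> g)"
      unfolding c_def by (rule conv_power_expansion[OF g])
    also have "\<dots> = c ?p * ?p g + (\<Sum>\<chi>\<in>?I - {?p}. c \<chi> * \<chi> g)"
      by (rule sum.remove[OF finite_irreducible_characters principal_character_irreducible])
    \<comment> \<open>Indicator and degree of the principal character are 1, so its coefficient is
      \<open>1 / |G|\<close> for every \<open>k\<close>.\<close>
    also have "c ?p * ?p g = uniform_prob G g"
      using g by (simp add: c_def frobenius_schur_principal char_degree_principal uniform_prob_def)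
        (simp add: principal_character_def)
    finally show ?thesis by simp
  qed
  have "group_inner G ?F ?F =
    group_inner G (\<lambda>g. \<Sum>\<chi>\<in>?I - {?p}. c \<chi> * \<chi> g) (\<lambda>g. \<Sum>\<chi>\<in>?I - {?p}. c \<chi> * \<chi> g)"
    using F F by (rule group_inner_cong)
  also have "\<dots> = (\<Sum>\<chi>\<in>?I - {?p}. c \<chi> * cnj (c \<chi>))"
    using finite_irreducible_characters by (intro group_inner_combination) auto
  also have "\<dots> = (\<Sum>\<chi>\<in>real_irreducible_characters G.
      of_real ((1 / ?N)\<^sup>2 * char_degree G \<chi> powi (2 * (- int (Suc k) + 1))))"
  proof (rule sum.mono_neutral_cong_right)
    show "real_irreducible_characters G \<subseteq> ?I - {?p}" by (auto simp: real_irreducible_characters_def)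
    show "\<forall>\<chi>\<in>?I - {?p} - real_irreducible_characters G. c \<chi> * cnj (c \<chi>) = 0"
    proof
      fix \<chi> assume "\<chi> \<in> ?I - {?p} - real_irreducible_characters G"
      then have "\<chi> \<in> ?I" "\<not> (\<forall>g\<in>carrier G. \<chi> g \<in> \<real>)"
        by (auto simp: real_irreducible_characters_def)
      then have "frobenius_schur \<chi> = 0" by (rule frobenius_schur_eq_0)
      \<comment> \<open>The exponent \<open>Suc k\<close> is positive, so a zero indicator gives a
        zero coefficient; this is where \<open>n \<ge> 1\<close> matters.\<close>
      then show "c \<chi> * cnj (c \<chi>) = 0" by (simp add: c_def)
    qed
    fix \<chi> assume \<chi>: "\<chi> \<in> real_irreducible_characters G"
    then have I: "\<chi> \<in> ?I" and fs: "(frobenius_schur \<chi>)\<^sup>2 = 1"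
      using frobenius_schur_square by (auto simp: real_irreducible_characters_def)
    \<comment> \<open>The coefficient is real, so its squared modulus contains only even powers, and
      the sign of the indicator disappears.\<close>
    have "c \<chi> * cnj (c \<chi>) = ((frobenius_schur \<chi>)\<^sup>2) ^ Suc k / (of_real ?N ^ 2 * of_real (char_degree G \<chi>) ^ (2 * k))"
      by (simp add: c_def cnj_frobenius_schur[OF I] power2_eq_square power_mult_distrib power_mult mult_ac power_add mult_2)
    also have "\<dots> = of_real ((1 / ?N)\<^sup>2 * inverse (char_degree G \<chi> ^ (2 * k)))"
      unfolding fs by (simp add: field_simps)
    \<comment> \<open>With \<open>n = Suc k\<close> the integer exponent is \<open>- 2 * k\<close>,
      so \<open>powi\<close> is the inverse of a natural power, also for
      \<open>k = 0\<close>.\<close>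
    also have "inverse (char_degree G \<chi> ^ (2 * k)) = char_degree G \<chi> powi (2 * (- int (Suc k) + 1))"
      by (simp add: power_int_def nat_mult_distrib power_inverse)
    finally show "c \<chi> * cnj (c \<chi>) = of_real ((1 / ?N)\<^sup>2 * char_degree G \<chi> powi (2 * (- int (Suc k) + 1)))" .
  qed (use finite_irreducible_characters in auto)
  also have "\<dots> = of_real ((1 / ?N)\<^sup>2 *
      (\<Sum>\<chi>\<in>real_irreducible_characters G. char_degree G \<chi> powi (2 * (- int (Suc k) + 1))))"
    by (simp only: of_real_sum sum_distrib_left)
  finally have "Re (group_inner G ?F ?F) = (1 / ?N)\<^sup>2 *
      (\<Sum>\<chi>\<in>real_irreducible_characters G. char_degree G \<chi> powi (2 * (- int (Suc k) + 1)))"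
    by (simp only: Re_complex_of_real)
  then show ?thesis
    unfolding group_norm_def by (simp add: real_sqrt_mult real_sqrt_divide)
qed

end

theorem theorem1:
  fixes G :: "('a, 'b) monoid_scheme" and n :: nat
  assumes "group G" and "finite (carrier G)" and "n \<ge> 1"
  shows "group_norm G (\<lambda>g. conv_power G (square_prob G) n g - uniform_prob G g) =
    1 / real (Coset.order G) *
      sqrt (\<Sum>\<chi>\<in>real_irreducible_characters G. char_degree G \<chi> powi (2 * (- int n + 1)))"
proof -
  interpret fin_group G
    using assms by (simp add: fin_group_def fin_group_axioms_def)
  from \<open>n \<ge> 1\<close> obtain k where "n = Suc k" by (cases n) auto
  then show ?thesis using group_norm_conv_power[of k] by simp
qed

end
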